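(* Let $d\ge 1$ and let $C\in\mathbb{R}^{d\times d}$ satisfy Condition A. Let $L$ be the normalized Fokker–Planck operator $Lf=-\mathrm{div}_x\big(C_S\nabla_x f+Cxf\big)$ on $\mathcal H=L^2(\mathbb{R}^d,f_\infty^{-1})$, with solution operator $e^{-Lt}$, $t\ge0$. Then $$\big\|e^{-Lt}\big\|_{\mathcal{B}(V_0^\perp)}=\big\|e^{-Ct}\big\|_{\mathcal{B}(\mathbb{R}^d)}\qquad\text{for all } t\ge 0 .$$
   Context: $C_S:=\frac12(C+C^T)$. Condition A on $C$: (1) $C_S$ is positive semi-definite; (2) there is no non-trivial $C^T$-invariant subspace of $\ker C_S$. $f_\infty(x)=(2\pi)^{-d/2}e^{-|x|^2/2}$ is the standard Gaussian, and $\mathcal H=L^2(\mathbb{R}^d,f_\infty^{-1})$ is the real Hilbert space with inner product $\langle f,g\rangle_{\mathcal H}=\int_{\mathbb{R}^d} f g\, f_\infty^{-1}\,dx$. $e^{-Lt}f_0$ denotes the solution at time $t$ of $\partial_t f=\mathrm{div}_x(C_S\nabla_x f+Cxf)$ with $f(0)=f_0\in\mathcal H$. $V_0=\mathrm{span}_{\mathbb R}\{f_\infty\}$ and $\Pi_0 f=\langle f,f_\infty\rangle_{\mathcal H}f_\infty$. By definition $\|e^{-Lt}\|_{\mathcal B(V_0^\perp)}:=\|e^{-Lt}(\mathbb 1-\Pi_0)\|_{\mathcal B(\mathcal H)}=\sup_{0\ne f_0\in\mathcal H}\frac{\|e^{-Lt}f_0-\Pi_0 f_0\|_{\mathcal H}}{\|f_0\|_{\mathcal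 H}}$, and $\|e^{-Ct}\|_{\mathcal B(\mathbb R^d)}=\sup_{0\ne x_0\in\mathbb R^d}\|e^{-Ct}x_0\|_2/\|x_0\|_2$ with the Euclidean norm $\|\cdot\|_2$. *)

theory Defs
  imports "HOL-Analysis.Analysis"
begin

fun matpow :: "real^'n^'n \<Rightarrow> nat \<Rightarrow> real^'n^'n" where
  "matpow A 0 = mat 1"
| "matpow A (Suc k) = A ** matpow A k"

definition mat_exp :: "real^'n^'n \<Rightarrow> real^'n^'n" where
  "mat_exp A = (\<Sum>k. (1 / fact k) *\<^sub>R matpow A k)"

definition mtrace :: "real^'n^'n \<Rightarrow> real" where
  "mtrace A = (\<Sum>i\<in>UNIV. A $ i $ i)"

definition sym_part :: "real^'n^'n \<Rightarrow> real^'n^'n" where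
  "sym_part C = (1/2) *\<^sub>R (C + transpose C)"

definition conditionA :: "real^'n^'n \<Rightarrow> bool" where
  "conditionA C \<longleftrightarrow>
     (\<forall>x. 0 \<le> x \<bullet> (sym_part C *v x)) \<and>
     (\<forall>V. subspace V \<and> V \<subseteq> {x. sym_part C *v x = 0} \<and>
          (\<forall>v\<in>V. transpose C *v v \<in> V) \<longrightarrow> V = {0})"

definition f_inf :: "real^'n \<Rightarrow> real" where
  "f_inf x = (2 * pi) powr (- real CARD('n) / 2) * exp (- (norm x)\<^sup>2 / 2)"

definition in_H :: "(real^'n \<Rightarrow> real) \<Rightarrow> bool" where
  "in_H f \<longleftrightarrow> f \<in> borel_measurable lborel \<and>
               integrable lborel (\<lambda>x. (f x)\<^sup>2 / f_inf x)"

definition H_inner :: "(real^'n \<Rightarrow> real) \<Rightarrow> (real^'n \<Rightarrow> real) \<Rightarrow> real" where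
  "H_inner f g = (LINT x|lborel. f x * g x / f_inf x)"

definition H_norm :: "(real^'n \<Rightarrow> real) \<Rightarrow> real" where
  "H_norm f = sqrt (H_inner f f)"

text \<open>Orthogonal projection onto V_0 = span{f_inf}.\<close>
definition Pi0 :: "(real^'n \<Rightarrow> real) \<Rightarrow> (real^'n \<Rightarrow> real)" where
  "Pi0 f = (\<lambda>x. H_inner f f_inf * f_inf x)"

section \<open>Solutions of the Fokker--Planck equation d/dt f = div(C_S grad f + C x f)\<close>

definition test_fun ::
  "(real^'n \<Rightarrow> real) \<Rightarrow> (real^'n \<Rightarrow> real^'n) \<Rightarrow> (real^'n \<Rightarrow> real^'n^'n) \<Rightarrow> bool" where
  "test_fun \<phi> g Hs \<longleftrightarrow>
     (\<forall>x. (\<phi> has_derivative (\<lambda>h. g x \<bullet> h)) (at x)) \<and>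
     (\<forall>x. (g has_derivative (\<lambda>h. Hs x *v h)) (at x)) \<and>
     continuous_on UNIV Hs \<and>
     compact (closure {x. \<phi> x \<noteq> 0})"

text \<open>Formal adjoint of L applied to a test function:
  L^* phi = tr(C_S D^2 phi) - (C x) . grad phi.\<close>
definition FP_adj ::
  "real^'n^'n \<Rightarrow> (real^'n \<Rightarrow> real^'n) \<Rightarrow> (real^'n \<Rightarrow> real^'n^'n) \<Rightarrow> real^'n \<Rightarrow> real" where
  "FP_adj C g Hs x = mtrace (sym_part C ** Hs x) - (C *v x) \<bullet> g x"

text \<open>f is a (weak) solution in C([0,\<infinity>); H) of the Fokker--Planck equation
  with initial datum f0.\<close>
definition FP_solution ::
  "real^'n^'n \<Rightarrow> (real^'n \<Rightarrow> real) \<Rightarrow> (real \<Rightarrow> real^'n \<Rightarrow> real) \<Rightarrow> bool" where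
  "FP_solution C f0 f \<longleftrightarrow>
     (\<forall>t\<ge>0. in_H (f t)) \<and>
     H_norm (\<lambda>x. f 0 x - f0 x) = 0 \<and>
     (\<forall>s\<ge>0. ((\<lambda>t. H_norm (\<lambda>x. f t x - f s x)) \<longlongrightarrow> 0) (at s within {0..})) \<and>
     (\<forall>\<phi> g Hs. test_fun \<phi> g Hs \<longrightarrow>
        (\<forall>t\<ge>0. ((\<lambda>\<tau>. LINT x|lborel. f \<tau> x * \<phi> x) has_real_derivative
                  (LINT x|lborel. f t x * FP_adj C g Hs x)) (at t within {0..})))"

end

theory Submission
  imports Defs "HOL-Probability.Characteristic_Functions"
begin

text \<open>
  Write \<open>K = exp (- t C)\<close> and \<open>wave \<xi> \<theta> x = exp (\<bar>\<xi>\<bar>\<^sup>2 / 2) cos (\<xi> \<bullet> x + \<theta>)\<close>. Testing the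
  equation with waves turns it into a transport equation for \<open>\<xi>\<close> along \<open>C\<^sup>T\<close>: pairing the solution
  at time \<open>t\<close> with \<open>wave \<xi> \<theta>\<close> equals pairing the initial datum with \<open>wave (K\<^sup>T \<xi>) \<theta>\<close>.
  The Gaussian inner product of two waves is
  \<open>cos \<theta> cos \<omega> cosh (\<xi> \<bullet> \<eta>) + sin \<theta> sin \<omega> sinh (\<xi> \<bullet> \<eta>)\<close>, a power series in
  \<open>\<xi> \<bullet> \<eta>\<close> with nonnegative coefficients whose constant term is the contribution of the means. By the
  Schur product theorem replacing \<open>\<xi>\<close> by \<open>K\<^sup>T \<xi>\<close> contracts the terms of degree \<open>n \<ge> 1\<close> by
  \<open>\<bar>K\<bar>\<^sup>2\<^sup>n \<le> \<bar>K\<bar>\<^sup>2\<close>, and density of the trigonometric polynomials gives the upper bound.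
  The degree one terms, reached by \<open>sin (\<epsilon> \<xi> \<bullet> x)\<close> as \<open>\<epsilon> \<rightarrow> 0\<close>, give equality.
\<close>

section \<open>Gaussian integrals and the weighted pairing\<close>

text \<open>The equation is available only in weak form, against fixed compactly supported C^2
  functions, for a solution that is continuous in norm. Waves have no compact support and their
  frequency has to move in time, which forces the cutoff \<open>bump\<close> and a product rule for
  moving test functions. On a wave of frequency y the adjoint operator produces - (y . C_S y) times
  the wave plus a drift term linear in x. If y' = C^T y, the drift term is exactly minus the time
  derivative of the phase factor; and since |y|^2 / 2 then has derivative y . C_S y, the factor exp
  (|y|^2 / 2) removes the decay term. This is where the normalization of the waves comes from. The
  same derivative, being nonnegative, shows that |y| is nondecreasing, hence |K| \<le> 1, without
  which the terms of high degree could not be bounded by |K|^2.\<close>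

lemma f_inf_pos [simp]: "0 < f_inf x"
  by (simp add: f_inf_def)

lemma f_inf_nonneg [simp]: "0 \<le> f_inf x" and f_inf_neq_0 [simp]: "f_inf x \<noteq> 0"
  using f_inf_pos[of x] by linarith+

lemma continuous_on_f_inf: "continuous_on A f_inf"
  unfolding f_inf_def[abs_def] by (intro continuous_intros) auto

lemma f_inf_measurable [measurable]: "f_inf \<in> borel_measurable borel"
  by (intro borel_measurable_continuous_onI continuous_on_f_inf)

lemma norm_square_eq_sum_Basis: "(norm x)\<^sup>2 = (\<Sum>b\<in>Basis. (x \<bullet> b)\<^sup>2)" for x :: "'a::euclidean_space"
  using euclidean_inner[of x x] by (simp add: power2_norm_eq_inner power2_eq_square[of "x \<bullet> _"])

lemma f_inf_eq_prod: "f_inf (x :: real^'n) = (\<Prod>b\<in>Basis. std_normal_density (x \<bullet> b))"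
proof -
  have "(2 * pi) powr (- real CARD('n) / 2) = ((2 * pi) powr (- (1 / 2))) powr real CARD('n)"
    unfolding powr_powr by simp
  also have "\<dots> = (1 / sqrt (2 * pi)) ^ CARD('n)"
    unfolding powr_minus_divide by (simp add: powr_half_sqrt powr_realpow)
  finally have "(2 * pi) powr (- real CARD('n) / 2) = (1 / sqrt (2 * pi)) ^ CARD('n)" .
  then show ?thesis
    by (simp add: f_inf_def norm_square_eq_sum_Basis std_normal_density_def prod.distrib prod_dividef power_divide
        sum_negf sum_divide_distrib flip: exp_sum)
qed

text \<open>\<open>lborel_eq\<close> presents Lebesgue measure as the image of a product of
  one-dimensional ones under the coordinate map, so Fubini reduces Gaussian integrals to the line.
  The values lie in a general field because both real and complex factors occur.\<close>

lemma
  fixes h :: "'a::euclidean_space \<Rightarrow> real \<Rightarrow> 'b::{real_normed_field,banach,second_countable_topology}"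
  assumes "\<And>b. b \<in> Basis \<Longrightarrow> integrable lborel (h b)"
  shows integrable_lborel_prod: "integrable lborel (\<lambda>x::'a. \<Prod>b\<in>Basis. h b (x \<bullet> b))"
    and integral_lborel_prod:
      "(LINT x|lborel. (\<Prod>b\<in>Basis. h b ((x::'a) \<bullet> b))) = (\<Prod>b\<in>Basis. (LINT y|lborel. h b y))"
proof -
  interpret product_sigma_finite "\<lambda>_::'a. lborel :: real measure" ..
  have [measurable]: "h b \<in> borel_measurable borel" if "b \<in> Basis" for b
    using borel_measurable_integrable[OF assms[OF that]] by simp
  have inner: "(\<Sum>b\<in>Basis. f b *\<^sub>R b) \<bullet> c = f c" if "c \<in> Basis" for f and c :: 'a
    using that by simp
  have eq: "(\<Prod>b\<in>Basis. h b ((\<Sum>b\<in>Basis. f b *\<^sub>R b) \<bullet> b)) = (\<Prod>b\<in>Basis. h b (f b))" for f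
    by (intro prod.cong refl) (simp add: inner)
  show "integrable lborel (\<lambda>x::'a. \<Prod>b\<in>Basis. h b (x \<bullet> b))"
    by (subst lborel_eq, subst integrable_distr_eq)
       (auto simp: eq intro!: product_integrable_prod assms)
  show "(LINT x|lborel. (\<Prod>b\<in>Basis. h b ((x::'a) \<bullet> b))) = (\<Prod>b\<in>Basis. (LINT y|lborel. h b y))"
    by (subst lborel_eq, subst integral_distr)
       (auto simp: eq intro!: product_integral_prod assms)
qed

text \<open>The complex exponential is used because, unlike the cosine, it factors over the
  coordinates; each factor is the characteristic function of the standard normal distribution.
  Cosines follow as real parts.\<close>

lemma
  shows integrable_cis_f_inf: "integrable lborel (\<lambda>x::real^'n. cis (\<xi> \<bullet> x) * f_inf x)" 
    and integral_cis_f_inf: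
      "(LINT x|lborel. cis (\<xi> \<bullet> (x::real^'n)) * f_inf x) = exp (- (norm \<xi>)\<^sup>2 / 2)"
proof -
  define h where "h b y = std_normal_density y *\<^sub>R iexp ((\<xi> \<bullet> b) * y)" for b y
  have int: "integrable lborel (h b)" for b
    unfolding h_def
    by (rule Bochner_Integration.integrable_bound[OF integrable_normal_density[of 1 0]])
       (auto simp: normal_density_nonneg)
  have I: "integral\<^sup>L lborel (h b) = exp (- (\<xi> \<bullet> b)\<^sup>2 / 2)" for b
  proof -
    have "integral\<^sup>L lborel (h b) = char std_normal_distribution (\<xi> \<bullet> b)"
      unfolding h_def char_def by (subst integral_density) (auto simp: normal_density_nonneg)
    then show ?thesis
      by (simp add: char_std_normal_distribution)
  qed
  have eq: "cis (\<xi> \<bullet> x) * f_inf x = (\<Prod>b\<in>Basis. h b (x \<bullet> b))" for x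
    by (simp add: h_def f_inf_eq_prod scaleR_conv_of_real prod.distrib cis_conv_exp
        euclidean_inner[of \<xi> x] sum_distrib_left exp_sum)
  show "integrable lborel (\<lambda>x::real^'n. cis (\<xi> \<bullet> x) * f_inf x)"
    unfolding eq by (intro integrable_lborel_prod int)
  have "(LINT x|lborel. cis (\<xi> \<bullet> (x::real^'n)) * f_inf x) = (\<Prod>b\<in>Basis. exp (- (\<xi> \<bullet> b)\<^sup>2 / 2))"
    unfolding eq by (subst integral_lborel_prod) (auto simp: int I)
  also have "\<dots> = exp (- (norm \<xi>)\<^sup>2 / 2)"
    by (simp add: norm_square_eq_sum_Basis sum_negf sum_divide_distrib flip: exp_sum)
  finally show "(LINT x|lborel. cis (\<xi> \<bullet> (x::real^'n)) * f_inf x) = exp (- (norm \<xi>)\<^sup>2 / 2)"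
    by simp
qed

lemma
  shows integrable_cos_f_inf: "integrable lborel (\<lambda>x::real^'n. cos (\<xi> \<bullet> x + \<theta>) * f_inf x)"
    and integral_cos_f_inf:
      "(LINT x|lborel. cos (\<xi> \<bullet> (x::real^'n) + \<theta>) * f_inf x) = exp (- (norm \<xi>)\<^sup>2 / 2) * cos \<theta>"
proof -
  have eq: "cos (\<xi> \<bullet> x + \<theta>) * f_inf x = Re (cis \<theta> * (cis (\<xi> \<bullet> x) * f_inf x))" for x
    by (simp add: cos_add algebra_simps)
  have int: "integrable lborel (\<lambda>x::real^'n. cis \<theta> * (cis (\<xi> \<bullet> x) * f_inf x))"
    by (intro integrable_mult_right integrable_cis_f_inf)
  show "integrable lborel (\<lambda>x::real^'n. cos (\<xi> \<bullet> x + \<theta>) * f_inf x)"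
    unfolding eq by (intro integrable_Re int)
  show "(LINT x|lborel. cos (\<xi> \<bullet> (x::real^'n) + \<theta>) * f_inf x) = exp (- (norm \<xi>)\<^sup>2 / 2) * cos \<theta>"
    unfolding eq integral_Re[OF int] integral_mult_right_zero integral_cis_f_inf
    by (simp add: mult.commute)
qed

lemma integrable_f_inf: "integrable lborel (f_inf :: real^'n \<Rightarrow> real)"
  using integrable_cos_f_inf[of 0 0] by simp

lemma integrable_poly_f_inf: "integrable lborel (\<lambda>x::real^'n. (1 + (norm x)\<^sup>2)\<^sup>2 * f_inf x)"
proof -
  have int: "integrable lborel (\<lambda>x::real^'n. \<Prod>b\<in>Basis. normal_density 0 (sqrt 2) (x \<bullet> b))"
    by (intro integrable_lborel_prod integrable_normal_density) auto
  have eq: "(\<Prod>b\<in>Basis. normal_density 0 (sqrt 2) (x \<bullet> b)) =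
     (1 / sqrt (4 * pi)) ^ CARD('n) * exp (- (norm x)\<^sup>2 / 4)" for x :: "real^'n"
    by (simp add: normal_density_def prod.distrib prod_dividef power_divide norm_square_eq_sum_Basis
        sum_negf sum_divide_distrib flip: exp_sum)
  have "integrable lborel (\<lambda>x::real^'n. (1 / sqrt (4 * pi)) ^ CARD('n) * exp (- (norm x)\<^sup>2 / 4))"
    using int unfolding eq .
  then have int2: "integrable lborel (\<lambda>x::real^'n. exp (- (norm x)\<^sup>2 / 4))"
    by simp
  \<comment> \<open>64 is the square of 8: (1 + s) / 8 is at most exp (s / 8), and squaring this
    uses up half of the Gaussian exponent.\<close>
  have bound: "(1 + s)\<^sup>2 * exp (- s / 2) \<le> 64 * exp (- s / 4)" if "0 \<le> s" for s :: real
  proof -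
    have "(1 + s) / 8 \<le> 1 + s / 8"
      by (simp add: add_divide_distrib)
    also have "\<dots> \<le> exp (s / 8)"
      by (rule exp_ge_add_one_self)
    finally have "((1 + s) / 8)\<^sup>2 \<le> (exp (s / 8))\<^sup>2"
      using that by (intro power_mono) auto
    also have "\<dots> = exp (s / 4)"
      by (simp flip: exp_double)
    finally have "(1 + s)\<^sup>2 \<le> 64 * exp (s / 4)"
      by (simp add: power_divide)
    then have "(1 + s)\<^sup>2 * exp (- s / 2) \<le> 64 * exp (s / 4) * exp (- s / 2)"
      by (intro mult_right_mono) auto
    then show ?thesis
      by (simp add: mult.assoc flip: exp_add)
  qed
  show ?thesis
  proof (rule Bochner_Integration.integrable_bound)
    show "integrable lborel (\<lambda>x::real^'n.
        (2 * pi) powr (- real CARD('n) / 2) * 64 * exp (- (norm x)\<^sup>2 / 4))"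
      by (intro integrable_mult_right int2)
    show "AE x in lborel. norm ((1 + (norm (x::real^'n))\<^sup>2)\<^sup>2 * f_inf x)
        \<le> norm ((2 * pi) powr (- real CARD('n) / 2) * 64 * exp (- (norm x)\<^sup>2 / 4))"
      using bound[of "(norm _)\<^sup>2"]
      by (auto simp: f_inf_def abs_mult mult.left_commute intro!: mult_left_mono)
  qed measurable
qed

text \<open>The unweighted integral of f * \<phi> pairs H with L^2 of the Gaussian measure, since
  the weights f_inf and 1 / f_inf cancel. Test functions live in this space, and multiplication by
  f_inf identifies it isometrically with H.\<close>

definition L2_gauss :: "(real^'n \<Rightarrow> real) \<Rightarrow> bool" where
  "L2_gauss \<phi> \<longleftrightarrow> \<phi> \<in> borel_measurable borel \<and> integrable lborel (\<lambda>x. (\<phi> x)\<^sup>2 * f_inf x)"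

definition gauss_norm :: "(real^'n \<Rightarrow> real) \<Rightarrow> real" where
  "gauss_norm \<phi> = sqrt (LINT x|lborel. (\<phi> x)\<^sup>2 * f_inf x)"

lemma gauss_norm_nonneg [simp]: "0 \<le> gauss_norm \<phi>"
  by (simp add: gauss_norm_def)

lemma gauss_norm_square: "(gauss_norm \<phi>)\<^sup>2 = (LINT x|lborel. (\<phi> x)\<^sup>2 * f_inf x)"
  by (simp add: gauss_norm_def)

lemma H_norm_nonneg [simp]: "0 \<le> H_norm f"
  by (simp add: H_norm_def H_inner_def divide_nonneg_pos zero_le_square)

lemma H_norm_square: "(H_norm f)\<^sup>2 = (LINT x|lborel. (f x)\<^sup>2 / f_inf x)"
  by (simp add: H_norm_def H_inner_def power2_eq_square)

lemma quadratic_nonneg_imp_discriminant: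
  fixes a b c :: real
  assumes nonneg: "\<And>l. 0 \<le> a - 2 * l * b + l\<^sup>2 * c" and "0 \<le> c"
  shows "b\<^sup>2 \<le> a * c"
proof (cases "c = 0")
  case True
  \<comment> \<open>For c = 0 the expression is affine in l, and this l makes it equal to -1 unless
    b = 0.\<close>
  with nonneg[of "(a + 1) / (2 * b)"] show ?thesis
    by (cases "b = 0") (auto simp: field_simps)
next
  case False
  with nonneg[of "b / c"] \<open>0 \<le> c\<close> show ?thesis
    by (simp add: field_simps power2_eq_square)
qed

text \<open>Expand the weighted square of \<open>f x - l * (\<phi> x * f_inf x)\<close>:
  nonnegativity of its integral for all l is a discriminant inequality, and l = 1 and l = -1 already
  bound f * \<phi> by an integrable function.\<close>

lemma
  assumes f: "in_H f" and \<phi>: "L2_gauss \<phi>"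
  shows integrable_H_mult: "integrable lborel (\<lambda>x. f x * \<phi> x)"
    and H_Cauchy_Schwarz: "\<bar>LINT x|lborel. f x * \<phi> x\<bar> \<le> H_norm f * gauss_norm \<phi>"
proof -
  have [measurable]: "f \<in> borel_measurable borel" "\<phi> \<in> borel_measurable borel"
    and if2: "integrable lborel (\<lambda>x. (f x)\<^sup>2 / f_inf x)"
    and ip2: "integrable lborel (\<lambda>x. (\<phi> x)\<^sup>2 * f_inf x)"
    using f \<phi> by (auto simp: in_H_def L2_gauss_def)
  have sq: "(f x)\<^sup>2 / f_inf x - 2 * l * (f x * \<phi> x) + l\<^sup>2 * ((\<phi> x)\<^sup>2 * f_inf x)
      = (f x - l * (\<phi> x * f_inf x))\<^sup>2 / f_inf x" for l x
    by (simp add: field_simps power2_eq_square)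
  have sq_nonneg: "0 \<le> (f x)\<^sup>2 / f_inf x - 2 * l * (f x * \<phi> x) + l\<^sup>2 * ((\<phi> x)\<^sup>2 * f_inf x)" for l x
    unfolding sq by simp
  show int: "integrable lborel (\<lambda>x. f x * \<phi> x)"
  proof (rule Bochner_Integration.integrable_bound)
    show "integrable lborel (\<lambda>x. (f x)\<^sup>2 / f_inf x + (\<phi> x)\<^sup>2 * f_inf x)"
      using if2 ip2 by simp
    have "\<bar>f x * \<phi> x\<bar> \<le> (f x)\<^sup>2 / f_inf x + (\<phi> x)\<^sup>2 * f_inf x" for x
      using sq_nonneg[of x 1] sq_nonneg[of x "-1"] by (auto simp: abs_le_iff) 
    then show "AE x in lborel. norm (f x * \<phi> x) \<le> norm ((f x)\<^sup>2 / f_inf x + (\<phi> x)\<^sup>2 * f_inf x)"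
      by (intro always_eventually) (auto intro: order_trans[OF _ abs_ge_self])
  qed measurable
  have "(LINT x|lborel. f x * \<phi> x)\<^sup>2 \<le> (H_norm f)\<^sup>2 * (gauss_norm \<phi>)\<^sup>2"
  proof (rule quadratic_nonneg_imp_discriminant)
    fix l
    have "0 \<le> (LINT x|lborel. (f x)\<^sup>2 / f_inf x - 2 * l * (f x * \<phi> x) + l\<^sup>2 * ((\<phi> x)\<^sup>2 * f_inf x))"
      by (intro Bochner_Integration.integral_nonneg sq_nonneg)
    also have "\<dots> = (H_norm f)\<^sup>2 - 2 * l * (LINT x|lborel. f x * \<phi> x) + l\<^sup>2 * (gauss_norm \<phi>)\<^sup>2"
      using if2 ip2 int by (simp add: H_norm_square gauss_norm_square)
    finally show "0 \<le> (H_norm f)\<^sup>2 - 2 * l * (LINT x|lborel. f x * \<phi> x) + l\<^sup>2 * (gauss_norm \<phi>)\<^sup>2" .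
  qed simp
  then have "\<bar>LINT x|lborel. f x * \<phi> x\<bar>\<^sup>2 \<le> (H_norm f * gauss_norm \<phi>)\<^sup>2"
    by (simp add: power_mult_distrib)
  then show "\<bar>LINT x|lborel. f x * \<phi> x\<bar> \<le> H_norm f * gauss_norm \<phi>"
    by (rule power2_le_imp_le) simp
qed

text \<open>The second part is how a pointwise error with a small constant c becomes a small
  contribution to a pairing.\<close>

lemma L2_gauss_bound:
  fixes \<phi> :: "real^'n \<Rightarrow> real"
  assumes [measurable]: "\<phi> \<in> borel_measurable borel" and b: "\<And>x. \<bar>\<phi> x\<bar> \<le> c * (1 + (norm x)\<^sup>2)"
  shows "L2_gauss \<phi>" "gauss_norm \<phi> \<le> c * gauss_norm (\<lambda>x::real^'n. 1 + (norm x)\<^sup>2)"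
proof -
  have "0 \<le> c"
    using b[of 0] by simp
  have sq: "(\<phi> x)\<^sup>2 * f_inf x \<le> c\<^sup>2 * ((1 + (norm x)\<^sup>2)\<^sup>2 * f_inf x)" for x
    using power_mono[OF b[of x] abs_ge_zero, of 2]
    by (simp add: power_mult_distrib mult_right_mono flip: mult.assoc)
  show L2: "L2_gauss \<phi>"
    unfolding L2_gauss_def
  proof (intro conjI Bochner_Integration.integrable_bound
        [OF integrable_mult_right[OF integrable_poly_f_inf, of "c\<^sup>2"]])
    show "AE x in lborel. norm ((\<phi> x)\<^sup>2 * f_inf x) \<le> norm (c\<^sup>2 * ((1 + (norm x)\<^sup>2)\<^sup>2 * f_inf x))"
      using sq by (intro always_eventually) auto
  qed measurable
  have "(gauss_norm \<phi>)\<^sup>2 \<le> (LINT x::real^'n|lborel. c\<^sup>2 * ((1 + (norm x)\<^sup>2)\<^sup>2 * f_inf x))"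
    unfolding gauss_norm_square using L2
    by (intro integral_mono sq integrable_mult_right integrable_poly_f_inf) (auto simp: L2_gauss_def)
  also have "\<dots> = (c * gauss_norm (\<lambda>x::real^'n. 1 + (norm x)\<^sup>2))\<^sup>2"
    by (simp add: power_mult_distrib gauss_norm_square)
  finally show "gauss_norm \<phi> \<le> c * gauss_norm (\<lambda>x::real^'n. 1 + (norm x)\<^sup>2)"
    by (rule power2_le_imp_le) (simp add: \<open>0 \<le> c\<close>)
qed

lemma in_H_diff:
  assumes "in_H f" "in_H g"
  shows "in_H (\<lambda>x. f x - g x)"
proof -
  have [measurable]: "f \<in> borel_measurable borel" "g \<in> borel_measurable borel"
    using assms by (auto simp: in_H_def)
  have b: "(f x - g x)\<^sup>2 / f_inf x \<le> 2 * ((f x)\<^sup>2 / f_inf x) + 2 * ((g x)\<^sup>2 / f_inf x)" for x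
  proof -
    have "(f x - g x)\<^sup>2 \<le> 2 * (f x)\<^sup>2 + 2 * (g x)\<^sup>2"
      using zero_le_power2[of "f x + g x"] unfolding power2_sum power2_diff by linarith
    then have "(f x - g x)\<^sup>2 / f_inf x \<le> (2 * (f x)\<^sup>2 + 2 * (g x)\<^sup>2) / f_inf x"
      by (intro divide_right_mono) auto
    then show ?thesis by (simp add: add_divide_distrib)
  qed
  show ?thesis
    unfolding in_H_def
  proof (intro conjI Bochner_Integration.integrable_bound[where g = "\<lambda>x. (f x - g x)\<^sup>2 / f_inf x"])
    show "integrable lborel (\<lambda>x. 2 * ((f x)\<^sup>2 / f_inf x) + 2 * ((g x)\<^sup>2 / f_inf x))"
      using assms by (intro Bochner_Integration.integrable_add integrable_mult_right) (auto simp: in_H_def)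
    show "AE x in lborel. norm ((f x - g x)\<^sup>2 / f_inf x)
        \<le> norm (2 * ((f x)\<^sup>2 / f_inf x) + 2 * ((g x)\<^sup>2 / f_inf x))"
      using b by (intro always_eventually) (auto intro: order_trans[OF _ abs_ge_self])
  qed measurable
qed

lemma in_H_mult_f_inf: "in_H (\<lambda>x. \<phi> x * f_inf x) \<longleftrightarrow> L2_gauss \<phi>"
proof -
  have "(\<phi> x * f_inf x)\<^sup>2 / f_inf x = (\<phi> x)\<^sup>2 * f_inf x" for x
    by (simp add: power2_eq_square)
  moreover have "(\<lambda>x. \<phi> x * f_inf x) \<in> borel_measurable borel \<longleftrightarrow> \<phi> \<in> borel_measurable borel"
  proof
    assume [measurable]: "(\<lambda>x. \<phi> x * f_inf x) \<in> borel_measurable borel"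
    have "(\<lambda>x. (\<phi> x * f_inf x) / f_inf x) \<in> borel_measurable borel"
      by measurable
    then show "\<phi> \<in> borel_measurable borel" by simp
  next
    assume [measurable]: "\<phi> \<in> borel_measurable borel"
    show "(\<lambda>x. \<phi> x * f_inf x) \<in> borel_measurable borel" by measurable
  qed
  ultimately show ?thesis
    by (simp add: in_H_def L2_gauss_def)
qed

lemma H_norm_mult_f_inf: "H_norm (\<lambda>x. \<phi> x * f_inf x) = gauss_norm \<phi>"
  by (simp add: H_norm_def H_inner_def gauss_norm_def power2_eq_square mult.assoc mult.left_commute)

lemma gauss_norm_div_f_inf: "gauss_norm (\<lambda>x. f x / f_inf x) = H_norm f"
  using H_norm_mult_f_inf[of "\<lambda>x. f x / f_inf x"] by simp

lemma L2_gauss_div_f_inf: "L2_gauss (\<lambda>x. f x / f_inf x) \<longleftrightarrow> in_H f"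
  using in_H_mult_f_inf[of "\<lambda>x. f x / f_inf x"] by simp

text \<open>By duality: pairing f with f / f_inf gives the square of its norm, and splitting f = g +
  (f - g) reduces the claim to Cauchy-Schwarz. A vanishing norm is set aside before
  cancelling.\<close>

lemma H_norm_triangle:
  assumes f: "in_H f" and g: "in_H g"
  shows "H_norm f \<le> H_norm g + H_norm (\<lambda>x. f x - g x)"
proof (cases "H_norm f = 0")
  case False
  let ?\<phi> = "\<lambda>x. f x / f_inf x"
  have \<phi>: "L2_gauss ?\<phi>" and n: "gauss_norm ?\<phi> = H_norm f"
    using f by (simp_all add: L2_gauss_div_f_inf gauss_norm_div_f_inf)
  have "(H_norm f)\<^sup>2 = (LINT x|lborel. g x * ?\<phi> x + (f x - g x) * ?\<phi> x)"
    unfolding H_norm_square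
    by (intro Bochner_Integration.integral_cong refl) (simp add: power2_eq_square field_simps)
  also have "\<dots> = (LINT x|lborel. g x * ?\<phi> x) + (LINT x|lborel. (f x - g x) * ?\<phi> x)"
    by (intro Bochner_Integration.integral_add integrable_H_mult in_H_diff f g \<phi>)
  also have "\<dots> \<le> H_norm g * H_norm f + H_norm (\<lambda>x. f x - g x) * H_norm f"
    using H_Cauchy_Schwarz[OF g \<phi>] H_Cauchy_Schwarz[OF in_H_diff[OF f g] \<phi>] unfolding n by linarith
  also have "\<dots> = (H_norm g + H_norm (\<lambda>x. f x - g x)) * H_norm f"
    by (simp add: algebra_simps)
  finally show ?thesis
    using False less_le[of 0 "H_norm f"] by (simp add: power2_eq_square)
qed simp

section \<open>Second quantization of a contraction\<close>

text \<open>One inner product of the kernel is expanded in an orthonormal basis and absorbed into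
  the coefficients. This is the Schur product theorem in elementary form, and the reason why the
  inductions below keep c arbitrary.\<close>

lemma sum_sum_inner_eq:
  fixes \<xi> \<eta> :: "'i \<Rightarrow> 'a::euclidean_space"
  shows "(\<Sum>i\<in>I. \<Sum>j\<in>I. c i * c j * (\<xi> i \<bullet> \<xi> j * h i j)) =
    (\<Sum>b\<in>Basis. \<Sum>i\<in>I. \<Sum>j\<in>I. (c i * (\<xi> i \<bullet> b)) * (c j * (\<xi> j \<bullet> b)) * h i j)"
proof -
  have "c i * c j * (\<xi> i \<bullet> \<xi> j * h i j) =
      (\<Sum>b\<in>Basis. (c i * (\<xi> i \<bullet> b)) * (c j * (\<xi> j \<bullet> b)) * h i j)" for i j
    by (subst euclidean_inner) (simp add: sum_distrib_left sum_distrib_right mult_ac)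
  then have "(\<Sum>i\<in>I. \<Sum>j\<in>I. c i * c j * (\<xi> i \<bullet> \<xi> j * h i j)) =
    (\<Sum>i\<in>I. \<Sum>j\<in>I. \<Sum>b\<in>Basis. (c i * (\<xi> i \<bullet> b)) * (c j * (\<xi> j \<bullet> b)) * h i j)"
    by simp
  also have "\<dots> = (\<Sum>i\<in>I. \<Sum>b\<in>Basis. \<Sum>j\<in>I. (c i * (\<xi> i \<bullet> b)) * (c j * (\<xi> j \<bullet> b)) * h i j)"
    by (intro sum.cong refl sum.swap)
  also have "\<dots> = (\<Sum>b\<in>Basis. \<Sum>i\<in>I. \<Sum>j\<in>I. (c i * (\<xi> i \<bullet> b)) * (c j * (\<xi> j \<bullet> b)) * h i j)"
    by (rule sum.swap)
  finally show ?thesis .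
qed

lemma sum_sum_inner_eq_norm:
  fixes \<xi> :: "'i \<Rightarrow> 'a::real_inner"
  shows "(\<Sum>i\<in>I. \<Sum>j\<in>I. c i * c j * (\<xi> i \<bullet> \<xi> j)) = (norm (\<Sum>i\<in>I. c i *\<^sub>R \<xi> i))\<^sup>2"
  by (simp add: power2_norm_eq_inner inner_sum_left inner_sum_right sum_distrib_left mult_ac inner_commute)

lemma gram_power_nonneg:
  fixes \<xi> :: "'i \<Rightarrow> 'a::euclidean_space"
  shows "0 \<le> (\<Sum>i\<in>I. \<Sum>j\<in>I. c i * c j * (\<xi> i \<bullet> \<xi> j) ^ n)"
proof (induction n arbitrary: c)
  case 0
  have "(\<Sum>i\<in>I. \<Sum>j\<in>I. c i * c j * (\<xi> i \<bullet> \<xi> j) ^ 0) = (\<Sum>i\<in>I. c i) * (\<Sum>i\<in>I. c i)"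
    by (simp add: sum_product)
  then show ?case by simp
next
  case (Suc n)
  then show ?case
    unfolding power_Suc sum_sum_inner_eq by (rule sum_nonneg)
qed

context
  fixes T :: "'a::euclidean_space \<Rightarrow> 'a" and \<kappa> :: real
  assumes lin: "linear T" and bnd: "\<And>x. norm (T x) \<le> \<kappa> * norm x"
begin

text \<open>For n = 0 this is the norm bound applied to the single vector
  \<open>\<Sum>i\<in>I. c i *\<^sub>R \<xi> i\<close>; multiplying a positive kernel by Gram entries
  keeps it positive.\<close>

lemma gram_power_contraction_aux:
  "0 \<le> (\<Sum>i\<in>I. \<Sum>j\<in>I. c i * c j * ((\<xi> i \<bullet> \<xi> j) ^ n * (\<kappa>\<^sup>2 * (\<xi> i \<bullet> \<xi> j) - T (\<xi> i) \<bullet> T (\<xi> j))))"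
proof (induction n arbitrary: c)
  case 0
  have "(norm (\<Sum>i\<in>I. c i *\<^sub>R T (\<xi> i)))\<^sup>2 = (norm (T (\<Sum>i\<in>I. c i *\<^sub>R \<xi> i)))\<^sup>2"
    by (simp add: linear_sum[OF lin] linear_scale[OF lin])
  also have "\<dots> \<le> (\<kappa> * norm (\<Sum>i\<in>I. c i *\<^sub>R \<xi> i))\<^sup>2"
    by (intro power_mono bnd) auto
  finally show ?case
    unfolding power_mult_distrib sum_sum_inner_eq_norm[symmetric]
    by (simp add: right_diff_distrib sum_subtractf sum_distrib_left mult_ac)
next
  case (Suc n)
  have "(\<Sum>i\<in>I. \<Sum>j\<in>I. c i * c j * ((\<xi> i \<bullet> \<xi> j) ^ Suc n * (\<kappa>\<^sup>2 * (\<xi> i \<bullet> \<xi> j) - T (\<xi> i) \<bullet> T (\<xi> j))))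
    = (\<Sum>b\<in>Basis. \<Sum>i\<in>I. \<Sum>j\<in>I. (c i * (\<xi> i \<bullet> b)) * (c j * (\<xi> j \<bullet> b)) *
        ((\<xi> i \<bullet> \<xi> j) ^ n * (\<kappa>\<^sup>2 * (\<xi> i \<bullet> \<xi> j) - T (\<xi> i) \<bullet> T (\<xi> j))))"
    unfolding power_Suc mult.assoc[of "\<xi> _ \<bullet> \<xi> _"] by (rule sum_sum_inner_eq)
  also have "\<dots> \<ge> 0"
    by (intro sum_nonneg Suc)
  finally show ?case .
qed

text \<open>Factors are exchanged one at a time: one factor with T is absorbed into the
  coefficients, the induction hypothesis replaces the other n, and
  \<open>gram_power_contraction_aux\<close> handles the mixed kernel that remains.\<close>

lemma gram_power_contraction:
  "(\<Sum>i\<in>I. \<Sum>j\<in>I. c i * c j * (T (\<xi> i) \<bullet> T (\<xi> j)) ^ n)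
    \<le> (\<kappa>\<^sup>2) ^ n * (\<Sum>i\<in>I. \<Sum>j\<in>I. c i * c j * (\<xi> i \<bullet> \<xi> j) ^ n)"
proof (induction n arbitrary: c)
  case (Suc n)
  have "(\<Sum>i\<in>I. \<Sum>j\<in>I. c i * c j * (T (\<xi> i) \<bullet> T (\<xi> j)) ^ Suc n) =
     (\<Sum>b\<in>Basis. \<Sum>i\<in>I. \<Sum>j\<in>I. (c i * (T (\<xi> i) \<bullet> b)) * (c j * (T (\<xi> j) \<bullet> b)) *
        (T (\<xi> i) \<bullet> T (\<xi> j)) ^ n)"
    unfolding power_Suc by (rule sum_sum_inner_eq)
  also have "\<dots> \<le> (\<Sum>b\<in>Basis. (\<kappa>\<^sup>2) ^ n * (\<Sum>i\<in>I. \<Sum>j\<in>I. (c i * (T (\<xi> i) \<bullet> b)) * (c j * (T (\<xi> j) \<bullet> b)) *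
        (\<xi> i \<bullet> \<xi> j) ^ n))"
    by (intro sum_mono Suc)
  also have "\<dots> = (\<kappa>\<^sup>2) ^ n * (\<Sum>i\<in>I. \<Sum>j\<in>I. c i * c j * (T (\<xi> i) \<bullet> T (\<xi> j) * (\<xi> i \<bullet> \<xi> j) ^ n))"
    by (simp add: sum_sum_inner_eq flip: sum_distrib_left)
  also have "\<dots> \<le> (\<kappa>\<^sup>2) ^ n * (\<kappa>\<^sup>2 * (\<Sum>i\<in>I. \<Sum>j\<in>I. c i * c j * (\<xi> i \<bullet> \<xi> j) ^ Suc n))"
    using gram_power_contraction_aux[where c = c and I = I and \<xi> = \<xi> and n = n]
    by (intro mult_left_mono) (simp_all add: right_diff_distrib sum_subtractf sum_distrib_left mult_ac)
  finally show ?case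
    by (simp add: mult_ac)
qed simp

lemma gram_series_contraction:
  fixes a :: "nat \<Rightarrow> real" and \<xi> :: "'i \<Rightarrow> 'a"
  assumes "\<kappa>\<^sup>2 \<le> 1" and a: "\<And>n. 0 \<le> a n" "a 0 = 0"
    and h: "\<And>s. (\<lambda>n. a n * s ^ n) sums h s"
  shows "(\<Sum>i\<in>I. \<Sum>j\<in>I. c i * c j * h (T (\<xi> i) \<bullet> T (\<xi> j)))
    \<le> \<kappa>\<^sup>2 * (\<Sum>i\<in>I. \<Sum>j\<in>I. c i * c j * h (\<xi> i \<bullet> \<xi> j))"
proof (rule sums_le)
  let ?Q = "\<lambda>(\<xi> :: 'i \<Rightarrow> 'a) n. \<Sum>i\<in>I. \<Sum>j\<in>I. c i * c j * (\<xi> i \<bullet> \<xi> j) ^ n"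
  have *: "(\<lambda>n. a n * ?Q \<xi> n) sums (\<Sum>i\<in>I. \<Sum>j\<in>I. c i * c j * h (\<xi> i \<bullet> \<xi> j))" for \<xi> :: "'i \<Rightarrow> 'a"
  proof -
    have "(\<lambda>n. \<Sum>i\<in>I. \<Sum>j\<in>I. c i * c j * (a n * (\<xi> i \<bullet> \<xi> j) ^ n))
        sums (\<Sum>i\<in>I. \<Sum>j\<in>I. c i * c j * h (\<xi> i \<bullet> \<xi> j))"
      by (intro sums_sum sums_mult h)
    then show ?thesis
      by (simp add: sum_distrib_left mult_ac)
  qed
  show "(\<lambda>n. a n * ?Q (\<lambda>i. T (\<xi> i)) n) sums (\<Sum>i\<in>I. \<Sum>j\<in>I. c i * c j * h (T (\<xi> i) \<bullet> T (\<xi> j)))"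
    by (rule *)
  show "(\<lambda>n. \<kappa>\<^sup>2 * (a n * ?Q \<xi> n)) sums (\<kappa>\<^sup>2 * (\<Sum>i\<in>I. \<Sum>j\<in>I. c i * c j * h (\<xi> i \<bullet> \<xi> j)))"
    by (intro sums_mult *)
  show "a n * ?Q (\<lambda>i. T (\<xi> i)) n \<le> \<kappa>\<^sup>2 * (a n * ?Q \<xi> n)" for n
  proof (cases n)
    case (Suc m)
    have "?Q (\<lambda>i. T (\<xi> i)) n \<le> (\<kappa>\<^sup>2) ^ n * ?Q \<xi> n"
      by (rule gram_power_contraction)
    \<comment> \<open>Since n = m + 1, one factor \<open>\<kappa>\<^sup>2\<close> is kept and the
      other m are bounded by 1. The constant term, which would not contract, is excluded by
      \<open>a 0 = 0\<close>.\<close>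
    also have "\<dots> \<le> \<kappa>\<^sup>2 * ?Q \<xi> n"
      using assms(1) mult_left_mono[OF power_le_one[of "\<kappa>\<^sup>2" m], of "\<kappa>\<^sup>2"]
      by (intro mult_right_mono gram_power_nonneg) (simp add: Suc)
    finally show ?thesis
      using mult_left_mono[OF _ a(1)] by (simp add: mult.left_commute)
  qed (simp add: a)
qed

end

text \<open>The real part of exp (i (\<xi> . x + \<theta>)) divided by the Gaussian mean of exp (i
  \<xi> . x); up to the phase, the generating function of the Hermite polynomials at i \<xi>. Hence
  the mean is cos \<theta> for every frequency. The phase - pi / 2 gives sines.\<close>

definition wave :: "real^'n \<Rightarrow> real \<Rightarrow> real^'n \<Rightarrow> real" where
  "wave \<xi> \<theta> x = exp ((norm \<xi>)\<^sup>2 / 2) * cos (\<xi> \<bullet> x + \<theta>)"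

lemma wave_0 [simp]: "wave 0 \<theta> x = cos \<theta>"
  by (simp add: wave_def)

lemma wave_measurable [measurable]: "wave \<xi> \<theta> \<in> borel_measurable borel"
  unfolding wave_def[abs_def] by measurable

lemma abs_wave_le: "\<bar>wave \<xi> \<theta> x\<bar> \<le> exp ((norm \<xi>)\<^sup>2 / 2)"
  by (simp add: wave_def abs_mult)

lemma L2_gauss_bounded:
  assumes "\<phi> \<in> borel_measurable borel" "\<And>x. \<bar>\<phi> x\<bar> \<le> c"
  shows "L2_gauss \<phi>"
proof (rule L2_gauss_bound)
  have "0 \<le> c"
    using assms(2)[of 0] by simp
  then show "\<bar>\<phi> x\<bar> \<le> c * (1 + (norm x)\<^sup>2)" for x
    using assms(2)[of x] by (simp add: distrib_left add_increasing2)
qed fact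

lemma L2_gauss_wave: "L2_gauss (wave \<xi> \<theta>)"
  by (rule L2_gauss_bounded[OF wave_measurable abs_wave_le])

text \<open>Product-to-sum yields the frequencies \<xi> - \<eta> and \<xi> + \<eta>. By polarization
  the normalizing factors cancel all squared norms and leave the exponentials of \<xi> . \<eta> and
  - \<xi> . \<eta>, which the addition formulas regroup into cosh and sinh.\<close>

lemma
  shows integrable_wave_wave: "integrable lborel (\<lambda>x. wave \<xi> \<theta> x * wave \<eta> \<omega> x * f_inf x)"
    and integral_wave_wave: "(LINT x|lborel. wave \<xi> \<theta> x * wave \<eta> \<omega> x * f_inf x)
       = cos \<theta> * cos \<omega> * cosh (\<xi> \<bullet> \<eta>) + sin \<theta> * sin \<omega> * sinh (\<xi> \<bullet> \<eta>)"
proof -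
  let ?e = "exp ((norm \<xi>)\<^sup>2 / 2) * exp ((norm \<eta>)\<^sup>2 / 2) / 2"
  have eq: "wave \<xi> \<theta> x * wave \<eta> \<omega> x * f_inf x =
     ?e * (cos ((\<xi> - \<eta>) \<bullet> x + (\<theta> - \<omega>)) * f_inf x + cos ((\<xi> + \<eta>) \<bullet> x + (\<theta> + \<omega>)) * f_inf x)" for x
  proof -
    have "cos ((\<xi> - \<eta>) \<bullet> x + (\<theta> - \<omega>)) + cos ((\<xi> + \<eta>) \<bullet> x + (\<theta> + \<omega>))
      = 2 * (cos (\<xi> \<bullet> x + \<theta>) * cos (\<eta> \<bullet> x + \<omega>))"
      unfolding cos_times_cos by (simp add: inner_diff_left inner_add_left algebra_simps)
    then show ?thesis
      unfolding distrib_right[symmetric] by (simp add: wave_def)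
  qed
  show "integrable lborel (\<lambda>x. wave \<xi> \<theta> x * wave \<eta> \<omega> x * f_inf x)"
    unfolding eq by (intro integrable_mult_right Bochner_Integration.integrable_add integrable_cos_f_inf)
  have e: "exp ((norm \<xi>)\<^sup>2 / 2) * exp ((norm \<eta>)\<^sup>2 / 2) * exp (- (norm (\<xi> - \<eta>))\<^sup>2 / 2) = exp (\<xi> \<bullet> \<eta>)"
    "exp ((norm \<xi>)\<^sup>2 / 2) * exp ((norm \<eta>)\<^sup>2 / 2) * exp (- (norm (\<xi> + \<eta>))\<^sup>2 / 2) = exp (- (\<xi> \<bullet> \<eta>))"
    by (simp_all add: power2_norm_eq_inner inner_diff_left inner_diff_right inner_add_left
        inner_add_right inner_commute field_simps flip: exp_add)
  have "(LINT x|lborel. wave \<xi> \<theta> x * wave \<eta> \<omega> x * f_inf x) =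
     ?e * (exp (- (norm (\<xi> - \<eta>))\<^sup>2 / 2) * cos (\<theta> - \<omega>) + exp (- (norm (\<xi> + \<eta>))\<^sup>2 / 2) * cos (\<theta> + \<omega>))"
    unfolding eq by (simp add: integrable_cos_f_inf integral_cos_f_inf)
  also have "\<dots> = (exp (\<xi> \<bullet> \<eta>) * cos (\<theta> - \<omega>) + exp (- (\<xi> \<bullet> \<eta>)) * cos (\<theta> + \<omega>)) / 2"
    unfolding e[symmetric] by (simp add: algebra_simps)
  also have "\<dots> = cos \<theta> * cos \<omega> * cosh (\<xi> \<bullet> \<eta>) + sin \<theta> * sin \<omega> * sinh (\<xi> \<bullet> \<eta>)"
    by (simp add: cosh_def sinh_def cos_add cos_diff field_simps)
  finally show "(LINT x|lborel. wave \<xi> \<theta> x * wave \<eta> \<omega> x * f_inf x)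
       = cos \<theta> * cos \<omega> * cosh (\<xi> \<bullet> \<eta>) + sin \<theta> * sin \<omega> * sinh (\<xi> \<bullet> \<eta>)" .
qed

lemma gauss_norm_sum_square:
  fixes u :: "'i \<Rightarrow> real^'n \<Rightarrow> real"
  assumes "\<And>i j. i \<in> I \<Longrightarrow> j \<in> I \<Longrightarrow> integrable lborel (\<lambda>x. u i x * u j x * f_inf x)"
  shows "(gauss_norm (\<lambda>x. \<Sum>i\<in>I. a i * u i x))\<^sup>2
    = (\<Sum>i\<in>I. \<Sum>j\<in>I. a i * a j * (LINT x|lborel. u i x * u j x * f_inf x))"
proof -
  have "(\<Sum>i\<in>I. a i * u i x)\<^sup>2 * f_inf x =
      (\<Sum>i\<in>I. \<Sum>j\<in>I. a i * a j * (u i x * u j x * f_inf x))" for x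
    unfolding power2_eq_square sum_product unfolding sum_distrib_right by (simp add: mult_ac)
  then show ?thesis
    unfolding gauss_norm_square
    by (simp add: assms Bochner_Integration.integral_sum)
qed

text \<open>The second quantization of \<open>T\<close> maps \<open>wave \<xi> \<theta>\<close> to \<open>wave (T \<xi>) \<theta>\<close>; \<open>cos \<theta>\<close> is the mean of both.\<close>

lemma gauss_norm_wave_contraction:
  fixes T :: "real^'n \<Rightarrow> real^'n"
  assumes T: "linear T" "\<And>x. norm (T x) \<le> \<kappa> * norm x" and \<kappa>: "0 \<le> \<kappa>" "\<kappa> \<le> 1"
  shows "gauss_norm (\<lambda>x. \<Sum>i\<in>I. a i * (wave (T (\<xi> i)) (\<theta> i) x - cos (\<theta> i)))
    \<le> \<kappa> * gauss_norm (\<lambda>x. \<Sum>i\<in>I. a i * wave (\<xi> i) (\<theta> i) x)"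
proof (rule power2_le_imp_le)
  let ?c = "\<lambda>i. a i * cos (\<theta> i)" and ?s = "\<lambda>i. a i * sin (\<theta> i)"
  have int: "integrable lborel (\<lambda>x. (wave \<xi> \<theta> x - cos \<theta>) * (wave \<eta> \<omega> x - cos \<omega>) * f_inf x)"
    and eq: "(LINT x|lborel. (wave \<xi> \<theta> x - cos \<theta>) * (wave \<eta> \<omega> x - cos \<omega>) * f_inf x)
       = cos \<theta> * cos \<omega> * (cosh (\<xi> \<bullet> \<eta>) - 1) + sin \<theta> * sin \<omega> * sinh (\<xi> \<bullet> \<eta>)"
    for \<xi> \<eta> :: "real^'n" and \<theta> \<omega>
  proof -
    \<comment> \<open>The constant cos \<theta> is the wave of frequency 0, so every term is a
      product of two waves; the three products involving frequency 0 together contribute the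
      -1.\<close>
    have *: "(wave \<xi> \<theta> x - cos \<theta>) * (wave \<eta> \<omega> x - cos \<omega>) * f_inf x =
       wave \<xi> \<theta> x * wave \<eta> \<omega> x * f_inf x - wave \<xi> \<theta> x * wave 0 \<omega> x * f_inf x
       - wave 0 \<theta> x * wave \<eta> \<omega> x * f_inf x + wave 0 \<theta> x * wave 0 \<omega> x * f_inf x" for x
      by (simp add: algebra_simps)
    show "integrable lborel (\<lambda>x. (wave \<xi> \<theta> x - cos \<theta>) * (wave \<eta> \<omega> x - cos \<omega>) * f_inf x)"
      unfolding * by (intro Bochner_Integration.integrable_add
          Bochner_Integration.integrable_diff integrable_wave_wave)
    have "(LINT x|lborel. (wave \<xi> \<theta> x - cos \<theta>) * (wave \<eta> \<omega> x - cos \<omega>) * f_inf x) =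
       (LINT x|lborel. wave \<xi> \<theta> x * wave \<eta> \<omega> x * f_inf x)
       - (LINT x|lborel. wave \<xi> \<theta> x * wave 0 \<omega> x * f_inf x)
       - (LINT x|lborel. wave 0 \<theta> x * wave \<eta> \<omega> x * f_inf x)
       + (LINT x|lborel. wave 0 \<theta> x * wave 0 \<omega> (x::real^'n) * f_inf x)"
      unfolding * by (simp add: integrable_wave_wave del: wave_0)
    then show "(LINT x|lborel. (wave \<xi> \<theta> x - cos \<theta>) * (wave \<eta> \<omega> x - cos \<omega>) * f_inf x)
       = cos \<theta> * cos \<omega> * (cosh (\<xi> \<bullet> \<eta>) - 1) + sin \<theta> * sin \<omega> * sinh (\<xi> \<bullet> \<eta>)"
      unfolding integral_wave_wave by (simp add: algebra_simps)
  qed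
  \<comment> \<open>Subtracting 1 deletes the coefficient of degree 0, as
    \<open>gram_series_contraction\<close> demands.\<close>
  have cosh: "(\<lambda>n. (if even n \<and> n \<noteq> 0 then 1 / fact n else 0) * s ^ n) sums (cosh s - 1)" for s :: real
  proof -
    have "(\<lambda>n. (if even n then s ^ n /\<^sub>R fact n else 0) - (if n = 0 then 1 else 0)) sums (cosh s - 1)"
      using sums_If_finite_set[of "{0}" "\<lambda>_. 1::real"] by (intro sums_diff cosh_converges) simp
    then show ?thesis
      by (rule sums_cong[THEN iffD1, rotated]) (auto simp: divide_inverse)
  qed
  have sinh: "(\<lambda>n. (if odd n then 1 / fact n else 0) * s ^ n) sums sinh s" for s :: real
    using sinh_converges[of s] by (rule sums_cong[THEN iffD1, rotated]) (auto simp: divide_inverse)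
  have "\<kappa>\<^sup>2 \<le> 1"
    using \<kappa> by (simp add: power_le_one)
  note contr = gram_series_contraction[OF T this]
  have "(gauss_norm (\<lambda>x. \<Sum>i\<in>I. a i * (wave (T (\<xi> i)) (\<theta> i) x - cos (\<theta> i))))\<^sup>2 =
     (\<Sum>i\<in>I. \<Sum>j\<in>I. ?c i * ?c j * (cosh (T (\<xi> i) \<bullet> T (\<xi> j)) - 1)) +
     (\<Sum>i\<in>I. \<Sum>j\<in>I. ?s i * ?s j * sinh (T (\<xi> i) \<bullet> T (\<xi> j)))"
    unfolding gauss_norm_sum_square[OF int] eq by (simp add: distrib_left sum.distrib mult_ac)
  also have "\<dots> \<le> \<kappa>\<^sup>2 * (\<Sum>i\<in>I. \<Sum>j\<in>I. ?c i * ?c j * (cosh (\<xi> i \<bullet> \<xi> j) - 1)) +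
     \<kappa>\<^sup>2 * (\<Sum>i\<in>I. \<Sum>j\<in>I. ?s i * ?s j * sinh (\<xi> i \<bullet> \<xi> j))"
    by (intro add_mono contr[OF _ _ cosh] contr[OF _ _ sinh]) auto
  also have "(\<Sum>i\<in>I. \<Sum>j\<in>I. ?c i * ?c j * (cosh (\<xi> i \<bullet> \<xi> j) - 1)) =
     (\<Sum>i\<in>I. \<Sum>j\<in>I. ?c i * ?c j * cosh (\<xi> i \<bullet> \<xi> j)) - (\<Sum>i\<in>I. ?c i)\<^sup>2"
    by (simp add: right_diff_distrib sum_subtractf power2_eq_square sum_product)
  \<comment> \<open>The subtracted square is that of the mean of the original sum; dropping it means
    comparing with the full norm instead of the centred one.\<close>
  also have "\<kappa>\<^sup>2 * ((\<Sum>i\<in>I. \<Sum>j\<in>I. ?c i * ?c j * cosh (\<xi> i \<bullet> \<xi> j)) - (\<Sum>i\<in>I. ?c i)\<^sup>2)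
      \<le> \<kappa>\<^sup>2 * (\<Sum>i\<in>I. \<Sum>j\<in>I. ?c i * ?c j * cosh (\<xi> i \<bullet> \<xi> j))"
    by (intro mult_left_mono) auto
  also have "\<kappa>\<^sup>2 * (\<Sum>i\<in>I. \<Sum>j\<in>I. ?c i * ?c j * cosh (\<xi> i \<bullet> \<xi> j)) +
     \<kappa>\<^sup>2 * (\<Sum>i\<in>I. \<Sum>j\<in>I. ?s i * ?s j * sinh (\<xi> i \<bullet> \<xi> j)) =
     (\<kappa> * gauss_norm (\<lambda>x. \<Sum>i\<in>I. a i * wave (\<xi> i) (\<theta> i) x))\<^sup>2"
    unfolding power_mult_distrib gauss_norm_sum_square[OF integrable_wave_wave] integral_wave_wave
    by (simp add: distrib_left sum.distrib mult_ac)
  finally show "(gauss_norm (\<lambda>x. \<Sum>i\<in>I. a i * (wave (T (\<xi> i)) (\<theta> i) x - cos (\<theta> i))))\<^sup>2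
    \<le> (\<kappa> * gauss_norm (\<lambda>x. \<Sum>i\<in>I. a i * wave (\<xi> i) (\<theta> i) x))\<^sup>2"
    by simp
qed (simp add: \<kappa>)

section \<open>Density of trigonometric polynomials\<close>

text \<open>The inductive form makes closure under sums and products a matter of rule induction;
  \<open>trig_poly_eq_sum\<close> recovers the indexed family that the contraction estimate
  needs.\<close>

inductive trig_poly :: "(real^'n \<Rightarrow> real) \<Rightarrow> bool" where
  zero: "trig_poly (\<lambda>x. 0)"
| add_wave: "trig_poly p \<Longrightarrow> trig_poly (\<lambda>x. a * wave \<xi> \<theta> x + p x)"

lemma trig_poly_eq_sum:
  assumes "trig_poly p"
  shows "\<exists>(m::nat) a \<xi> \<theta>. p = (\<lambda>x. \<Sum>i<m. a i * wave (\<xi> i) (\<theta> i) x)"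
  using assms
proof induction
  case zero
  show ?case by (intro exI[of _ 0]) simp
next
  case (add_wave p b \<eta> \<omega>)
  then obtain m :: nat and a \<xi> \<theta> where p: "p = (\<lambda>x. \<Sum>i<m. a i * wave (\<xi> i) (\<theta> i) x)"
    by blast
  show ?case
    by (intro exI[of _ "Suc m"] exI[of _ "a(m := b)"] exI[of _ "\<xi>(m := \<eta>)"] exI[of _ "\<theta>(m := \<omega>)"])
       (simp add: p fun_eq_iff)
qed

lemma trig_poly_measurable: "trig_poly p \<Longrightarrow> p \<in> borel_measurable borel"
  by (induction rule: trig_poly.induct) auto

lemma trig_poly_wave: "trig_poly (\<lambda>x. a * wave \<xi> \<theta> x)"
  using trig_poly.add_wave[OF trig_poly.zero] by simp

lemma trig_poly_cos: "trig_poly (\<lambda>x. a * cos (\<xi> \<bullet> x + \<theta>))"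
proof -
  have "a * cos (\<xi> \<bullet> x + \<theta>) = a * exp (- (norm \<xi>)\<^sup>2 / 2) * wave \<xi> \<theta> x" for x
    by (simp add: wave_def flip: exp_add)
  then show ?thesis
    by (simp only: trig_poly_wave)
qed

lemma trig_poly_const: "trig_poly (\<lambda>x. c)"
  using trig_poly_cos[of c 0 0] by simp

lemma trig_poly_add: "trig_poly p \<Longrightarrow> trig_poly q \<Longrightarrow> trig_poly (\<lambda>x. p x + q x)"
  by (induction rule: trig_poly.induct) (auto simp: add.assoc intro: trig_poly.add_wave)

lemma trig_poly_sum: "finite I \<Longrightarrow> (\<And>i. i \<in> I \<Longrightarrow> trig_poly (p i)) \<Longrightarrow> trig_poly (\<lambda>x. \<Sum>i\<in>I. p i x)"
  by (induction rule: finite_induct) (auto intro: trig_poly_add trig_poly.zero)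

text \<open>Product-to-sum makes the trigonometric polynomials an algebra, which allows ordinary
  polynomials to be composed with sines.\<close>

lemma trig_poly_wave_mult: "trig_poly q \<Longrightarrow> trig_poly (\<lambda>x. a * wave \<xi> \<theta> x * q x)"
proof (induction rule: trig_poly.induct)
  case (add_wave q b \<eta> \<omega>)
  let ?c = "a * b * exp ((norm \<xi>)\<^sup>2 / 2) * exp ((norm \<eta>)\<^sup>2 / 2) / 2"
  have "a * wave \<xi> \<theta> x * (b * wave \<eta> \<omega> x + q x) =
      ?c * cos ((\<xi> - \<eta>) \<bullet> x + (\<theta> - \<omega>)) + ?c * cos ((\<xi> + \<eta>) \<bullet> x + (\<theta> + \<omega>)) + a * wave \<xi> \<theta> x * q x" for x
  proof -
    have "cos ((\<xi> - \<eta>) \<bullet> x + (\<theta> - \<omega>)) + cos ((\<xi> + \<eta>) \<bullet> x + (\<theta> + \<omega>))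
      = 2 * (cos (\<xi> \<bullet> x + \<theta>) * cos (\<eta> \<bullet> x + \<omega>))"
      unfolding cos_times_cos by (simp add: inner_diff_left inner_add_left algebra_simps)
    then show ?thesis
      unfolding distrib_left[of ?c, symmetric] by (simp add: wave_def distrib_left)
  qed
  then show ?case
    using add_wave.IH by (simp only: trig_poly_add trig_poly_cos)
qed (simp add: trig_poly.zero)

lemma trig_poly_mult: "trig_poly p \<Longrightarrow> trig_poly q \<Longrightarrow> trig_poly (\<lambda>x. p x * q x)"
  by (induction rule: trig_poly.induct)
     (auto simp: distrib_right trig_poly.zero intro: trig_poly_add trig_poly_wave_mult)

lemma trig_poly_polynomial_sin:
  assumes "real_polynomial_function P"
  shows "trig_poly (\<lambda>x::real^'n. P (\<chi> i. s * sin (x $ i / s)))"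
  using assms
proof induction
  case (linear f)
  \<comment> \<open>A linear f is determined by its values on the axes, and each sine is a cosine
    with phase - pi / 2.\<close>
  have "f (\<chi> i. s * sin (x $ i / s)) =
      (\<Sum>i\<in>UNIV. (s * f (axis i 1)) * cos (axis i (1 / s) \<bullet> x + (- pi / 2)))" for x
  proof -
    have "f (\<chi> i. s * sin (x $ i / s)) = f (\<Sum>i\<in>UNIV. (s * sin (x $ i / s)) *\<^sub>R axis i 1)"
      by (subst basis_expansion[symmetric]) (simp add: scalar_mult_eq_scaleR)
    also have "\<dots> = (\<Sum>i\<in>UNIV. (s * sin (x $ i / s)) * f (axis i 1))"
      using linear by (simp add: linear_sum linear_scale bounded_linear.linear)
    finally show ?thesis
      by (simp add: inner_axis' cos_diff mult_ac flip: minus_divide_left)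
  qed
  then show ?case
    by (simp only:) (intro trig_poly_sum trig_poly_cos finite)
qed (auto intro: trig_poly_add trig_poly_mult trig_poly_const)

text \<open>This is the difference quotient of sin (a * h) at 0 along h = 1 / (n + 1).\<close>

lemma n_sin_div_n_tendsto: "(\<lambda>n. real (Suc n) * sin (a / real (Suc n))) \<longlonglongrightarrow> a"
proof -
  have "((\<lambda>h. sin (a * h)) has_real_derivative a) (at 0)"
    by (auto intro!: derivative_eq_intros)
  then have "((\<lambda>h. sin (a * h) / h) \<longlongrightarrow> a) (at 0)"
    by (simp add: DERIV_def)
  moreover have "filterlim (\<lambda>n. inverse (real (Suc n))) (at 0) sequentially"
    by (intro filterlim_atI LIMSEQ_inverse_real_of_nat) auto
  ultimately have "(\<lambda>n. sin (a * inverse (real (Suc n))) / inverse (real (Suc n))) \<longlonglongrightarrow> a"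
    by (rule filterlim_compose)
  then show ?thesis
    by (simp add: divide_inverse mult.commute)
qed

text \<open>Polynomials in \<open>s * sin (x $ i / s)\<close> are trigonometric polynomials whose values are controlled
  on the whole space by the values of the polynomial on a cube; \<open>s\<close> tends to infinity.\<close>

lemma trig_poly_approximation:
  fixes F :: "real^'n \<Rightarrow> real"
  assumes F: "continuous_on UNIV F" and B: "\<And>x. \<bar>F x\<bar> \<le> B"
  obtains p where "\<And>n::nat. trig_poly (p n)" "\<And>n x. \<bar>p n x\<bar> \<le> B + 1" "\<And>x. (\<lambda>n. p n x) \<longlonglongrightarrow> F x"
proof -
  define y where "y n x = (\<chi> i. real (Suc n) * sin (x $ i / real (Suc n)))" for n and x :: "real^'n"
  have y: "norm (y n x) \<le> real CARD('n) * real (Suc n)" for n x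
  proof -
    have "norm (y n x) \<le> (\<Sum>i\<in>UNIV. \<bar>y n x $ i\<bar>)"
      by (rule norm_le_l1_cart)
    also have "\<dots> \<le> (\<Sum>i\<in>(UNIV::'n set). real (Suc n))"
      by (intro sum_mono) (simp add: y_def abs_mult mult_le_cancel_left1 del: of_nat_Suc)
    finally show ?thesis by simp
  qed
  have "\<exists>P. real_polynomial_function P \<and>
      (\<forall>x\<in>cball 0 (real CARD('n) * real (Suc n)). \<bar>F x - P x\<bar> < inverse (real (Suc n)))" for n
  proof -
    have "0 < inverse (real (Suc n))"
      by simp
    from Stone_Weierstrass_real_polynomial_function[OF compact_cball continuous_on_subset[OF F subset_UNIV] this]
    show ?thesis by metis
  qed
  then obtain P where P: "\<And>n. real_polynomial_function (P n)"
      "\<And>n x. x \<in> cball 0 (real CARD('n) * real (Suc n)) \<Longrightarrow> \<bar>F x - P n x\<bar> < inverse (real (Suc n))"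
    by metis
  have close: "\<bar>F (y n x) - P n (y n x)\<bar> < inverse (real (Suc n))" for n x
    by (intro P(2)) (use y in \<open>simp add: dist_norm\<close>)
  show ?thesis
  proof
    show "trig_poly (\<lambda>x. P n (y n x))" for n
      unfolding y_def by (intro trig_poly_polynomial_sin P)
    \<comment> \<open>The tolerance is at most 1 from the start, which gives a bound uniform in n
      for dominated convergence.\<close>
    have "inverse (real (Suc n)) \<le> 1" for n
      by (simp add: inverse_le_1_iff)
    then show "\<bar>P n (y n x)\<bar> \<le> B + 1" for n x
      using close[of n x] B[of "y n x"] by (smt (verit))
    show "(\<lambda>n. P n (y n x)) \<longlonglongrightarrow> F x" for x
    proof -
      have "(\<lambda>n. y n x) \<longlonglongrightarrow> x"
        by (rule vec_tendstoI) (simp add: y_def n_sin_div_n_tendsto del: of_nat_Suc)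
      then have lim: "(\<lambda>n. F (y n x)) \<longlonglongrightarrow> F x"
        by (intro continuous_on_tendsto_compose[OF F]) auto
      have "(\<lambda>n. F (y n x) - P n (y n x)) \<longlonglongrightarrow> 0"
        by (rule tendsto_rabs_zero_cancel,
            rule tendsto_sandwich[OF _ _ tendsto_const LIMSEQ_inverse_real_of_nat])
           (auto intro!: always_eventually less_imp_le close simp del: of_nat_Suc)
      from tendsto_diff[OF lim this] show ?thesis
        by simp
    qed
  qed
qed

text \<open>Dominated convergence on both sides. The uniform bound gives the majorants B * |g| and
  B^2 * f_inf, the first integrable because g pairs with the constant 1.\<close>

lemma weak_bound_limit:
  fixes g :: "real^'n \<Rightarrow> real"
  assumes g: "in_H g" and [measurable]: "\<And>n. p n \<in> borel_measurable borel" "h \<in> borel_measurable borel"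
    and B: "\<And>n x. \<bar>p n x\<bar> \<le> B" and lim: "AE x in lborel. (\<lambda>n. p n x) \<longlonglongrightarrow> h x"
    and le: "\<And>n. \<bar>LINT x|lborel. g x * p n x\<bar> \<le> M * gauss_norm (p n)"
  shows "\<bar>LINT x|lborel. g x * h x\<bar> \<le> M * gauss_norm h"
proof (rule LIMSEQ_le)
  have [measurable]: "g \<in> borel_measurable borel"
    using g by (simp add: in_H_def)
  have intg: "integrable lborel g"
    using integrable_H_mult[OF g L2_gauss_bounded[of "\<lambda>_. 1" 1]] by simp
  show "(\<lambda>n. \<bar>LINT x|lborel. g x * p n x\<bar>) \<longlonglongrightarrow> \<bar>LINT x|lborel. g x * h x\<bar>"
  proof (intro tendsto_rabs integral_dominated_convergence)
    show "integrable lborel (\<lambda>x. \<bar>g x\<bar> * B)"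
      using intg by simp
    show "AE x in lborel. (\<lambda>n. g x * p n x) \<longlonglongrightarrow> g x * h x"
      using lim by eventually_elim (intro tendsto_intros)
    show "AE x in lborel. norm (g x * p n x) \<le> \<bar>g x\<bar> * B" for n
      using B by (auto simp: abs_mult intro!: mult_left_mono)
  qed measurable
  show "(\<lambda>n. M * gauss_norm (p n)) \<longlonglongrightarrow> M * gauss_norm h"
    unfolding gauss_norm_def
  proof (intro tendsto_mult tendsto_const tendsto_real_sqrt integral_dominated_convergence)
    show "integrable lborel (\<lambda>x::real^'n. B\<^sup>2 * f_inf x)"
      by (intro integrable_mult_right integrable_f_inf)
    show "AE x in lborel. (\<lambda>n. (p n x)\<^sup>2 * f_inf x) \<longlonglongrightarrow> (h x)\<^sup>2 * f_inf x"
      using lim by eventually_elim (intro tendsto_intros)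
    show "AE x in lborel. norm ((p n x)\<^sup>2 * f_inf x) \<le> B\<^sup>2 * f_inf x" for n
      using power_mono[OF B abs_ge_zero, of _ _ 2] by (auto intro!: mult_right_mono)
  qed measurable
qed (use le in auto)

text \<open>Lebesgue measurable functions are almost everywhere limits of continuous ones. Clipping
  these to [-B, B] gives the uniform bound without changing the limit, since h takes its values
  there.\<close>

lemma continuous_AE_approximation:
  fixes h :: "real^'n \<Rightarrow> real"
  assumes "h \<in> borel_measurable borel" and B: "\<And>x. \<bar>h x\<bar> \<le> B"
  obtains F where "\<And>n::nat. continuous_on UNIV (F n)" "\<And>n x. \<bar>F n x\<bar> \<le> B"
    "AE x in lborel. (\<lambda>n. F n x) \<longlonglongrightarrow> h x"
proof -
  have "h \<in> borel_measurable lebesgue"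
    using assms(1) by (intro measurable_completion) simp
  then have "h measurable_on UNIV"
    by (rule lebesgue_measurable_imp_measurable_on) simp
  then obtain N F where N: "negligible N" and F: "\<And>n. continuous_on UNIV (F n)"
    and lim: "\<And>x. x \<notin> N \<Longrightarrow> (\<lambda>n. F n x) \<longlonglongrightarrow> h x"
    by (auto simp: measurable_on_def)
  have "0 \<le> B"
    using B[of 0] by simp
  show ?thesis
  proof
    show "continuous_on UNIV (\<lambda>x. max (- B) (min B (F n x)))" for n
      by (intro continuous_intros F)
    show "\<bar>max (- B) (min B (F n x))\<bar> \<le> B" for n x
      using \<open>0 \<le> B\<close> by auto
    have "AE x in lebesgue. (\<lambda>n. F n x) \<longlonglongrightarrow> h x"
      using N lim by (intro AE_I'[of N]) (auto simp: negligible_iff_null_sets)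
    then have "AE x in lborel. (\<lambda>n. F n x) \<longlonglongrightarrow> h x"
      by (simp add: AE_completion_iff)
    then show "AE x in lborel. (\<lambda>n. max (- B) (min B (F n x))) \<longlonglongrightarrow> h x"
    proof eventually_elim
      case (elim x)
      then have "(\<lambda>n. max (- B) (min B (F n x))) \<longlonglongrightarrow> max (- B) (min B (h x))"
        by (intro tendsto_intros)
      then show ?case
        using B[of x] by (simp add: abs_le_iff min_def max_def split: if_splits)
    qed
  qed
qed

text \<open>The optimal test function g / f_inf need not be a trigonometric polynomial, nor even
  bounded. Two limits extend the bound to bounded continuous and then to bounded measurable
  functions, among which are the truncations of g / f_inf.\<close>

theorem H_norm_le_if_trig_poly_bound:
  fixes g :: "real^'n \<Rightarrow> real"
  assumes g: "in_H g" and "0 \<le> M"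
    and bound: "\<And>p. trig_poly p \<Longrightarrow> \<bar>LINT x|lborel. g x * p x\<bar> \<le> M * gauss_norm p"
  shows "H_norm g \<le> M"
proof -
  have [measurable]: "g \<in> borel_measurable borel"
    using g by (simp add: in_H_def)
  have cont: "\<bar>LINT x|lborel. g x * F x\<bar> \<le> M * gauss_norm F"
    if F: "continuous_on UNIV F" "\<And>x. \<bar>F x\<bar> \<le> B" for F B
  proof -
    obtain p where p: "\<And>n::nat. trig_poly (p n)" "\<And>n x. \<bar>p n x\<bar> \<le> B + 1"
      "\<And>x. (\<lambda>n. p n x) \<longlonglongrightarrow> F x"
      using trig_poly_approximation[OF F] by blast
    show ?thesis
      by (rule weak_bound_limit[where p = p, OF g trig_poly_measurable[OF p(1)]
            borel_measurable_continuous_onI[OF F(1)] p(2) always_eventually bound[OF p(1)]])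
         (simp add: p(3))
  qed
  have bdd: "\<bar>LINT x|lborel. g x * h x\<bar> \<le> M * gauss_norm h"
    if h: "h \<in> borel_measurable borel" "\<And>x. \<bar>h x\<bar> \<le> B" for h B
  proof -
    obtain F where F: "\<And>n::nat. continuous_on UNIV (F n)" "\<And>n x. \<bar>F n x\<bar> \<le> B"
      "AE x in lborel. (\<lambda>n. F n x) \<longlonglongrightarrow> h x"
      using continuous_AE_approximation[OF h] by blast
    show ?thesis
      by (rule weak_bound_limit[where p = F, OF g borel_measurable_continuous_onI[OF F(1)] h(1) F(2,3) cont[OF F(1,2)]])
  qed
  define h where "h n x = max (- real n) (min (real n) (g x / f_inf x))" for n :: nat and x
  have [measurable]: "h n \<in> borel_measurable borel" for n
    unfolding h_def[abs_def] by measurable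
  have hb: "\<bar>h n x\<bar> \<le> real n" for n x
    by (auto simp: h_def)
  have max_min_abs: "\<bar>max (- real n) (min (real n) q)\<bar> \<le> \<bar>q\<bar>" for n q
    by (auto simp: max_def min_def)
  have abs_h: "\<bar>h n x\<bar> \<le> \<bar>g x / f_inf x\<bar>" for n x
    using max_min_abs[of n "g x / f_inf x"] by (simp only: h_def)
  \<comment> \<open>Truncation keeps the sign and does not increase the modulus, so the pairing of g
    with \<open>h n\<close> dominates the square of \<open>gauss_norm (h n)\<close>.\<close>
  have h_sq: "(h n x)\<^sup>2 \<le> (g x / f_inf x) * h n x" for n x
  proof -
    have "\<bar>h n x\<bar> * \<bar>h n x\<bar> \<le> \<bar>g x / f_inf x\<bar> * \<bar>h n x\<bar>"
      by (intro mult_right_mono abs_h) simp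
    moreover have "0 \<le> q * max (- real n) (min (real n) q)" for q
      by (auto simp: zero_le_mult_iff max_def min_def)
    then have "\<bar>(g x / f_inf x) * h n x\<bar> = (g x / f_inf x) * h n x"
      unfolding h_def by (intro abs_of_nonneg)
    ultimately show ?thesis
      unfolding abs_mult[symmetric] power2_eq_square by simp
  qed
  have "gauss_norm (h n) \<le> M" for n
  proof (cases "gauss_norm (h n) = 0")
    case False
    have L2: "L2_gauss (h n)"
      by (rule L2_gauss_bounded[OF _ hb]) measurable
    have "gauss_norm (h n) * gauss_norm (h n) = (LINT x|lborel. (h n x)\<^sup>2 * f_inf x)"
      by (simp add: gauss_norm_square flip: power2_eq_square)
    also have "\<dots> \<le> (LINT x|lborel. g x * h n x)"
    proof (rule integral_mono)
      show "integrable lborel (\<lambda>x. (h n x)\<^sup>2 * f_inf x)"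
        using L2 by (simp add: L2_gauss_def)
      show "integrable lborel (\<lambda>x. g x * h n x)"
        by (rule integrable_H_mult[OF g L2])
      show "(h n x)\<^sup>2 * f_inf x \<le> g x * h n x" for x
        using mult_right_mono[OF h_sq f_inf_nonneg, of n x x] by simp
    qed
    also have "\<dots> \<le> M * gauss_norm (h n)"
      using bdd[OF _ hb] by (simp add: abs_le_iff)
    finally show ?thesis
      using False less_le[of 0 "gauss_norm (h n)"] by simp
  qed (simp add: \<open>0 \<le> M\<close>)
  moreover have "(\<lambda>n. gauss_norm (h n)) \<longlonglongrightarrow> gauss_norm (\<lambda>x. g x / f_inf x)"
    unfolding gauss_norm_def
  proof (intro tendsto_real_sqrt integral_dominated_convergence)
    show "integrable lborel (\<lambda>x. (g x / f_inf x)\<^sup>2 * f_inf x)"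
      using g L2_gauss_div_f_inf[of g] by (simp add: L2_gauss_def)
    have "(\<lambda>n. h n x) \<longlonglongrightarrow> g x / f_inf x" for x
    proof (rule tendsto_eventually)
      obtain N where N: "\<bar>g x / f_inf x\<bar> \<le> real N"
        using real_arch_simple by blast
      have "h n x = g x / f_inf x" if "N \<le> n" for n
      proof -
        have "\<bar>g x / f_inf x\<bar> \<le> real n"
          using N that by linarith
        then show ?thesis
          unfolding h_def by linarith
      qed
      then show "\<forall>\<^sub>F n in sequentially. h n x = g x / f_inf x"
        by (auto simp: eventually_sequentially)
    qed
    then show "AE x in lborel. (\<lambda>n. (h n x)\<^sup>2 * f_inf x) \<longlonglongrightarrow> (g x / f_inf x)\<^sup>2 * f_inf x"
      by (intro always_eventually allI tendsto_intros)
    show "AE x in lborel. norm ((h n x)\<^sup>2 * f_inf x) \<le> (g x / f_inf x)\<^sup>2 * f_inf x" for n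
      using abs_le_square_iff[THEN iffD1, OF abs_h] by (intro always_eventually) (auto intro!: mult_right_mono)
  qed measurable
  ultimately have "gauss_norm (\<lambda>x. g x / f_inf x) \<le> M"
    by (intro LIMSEQ_le_const2) auto
  then show ?thesis
    by (simp add: gauss_norm_div_f_inf)
qed

section \<open>The adjoint flow and cut off waves\<close>

lemma matpow_commute: "matpow A k ** A = A ** matpow A k"
  by (induction k) (simp_all flip: matrix_mul_assoc)

lemma matpow_scaleR: "matpow (s *\<^sub>R A) k = s ^ k *\<^sub>R matpow A k"
proof (induction k)
  case (Suc k)
  have "(s *\<^sub>R A) ** (s ^ k *\<^sub>R matpow A k) = s ^ Suc k *\<^sub>R (A ** matpow A k)"
    by (simp add: matrix_matrix_mult_def vec_eq_iff sum_distrib_left mult_ac)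
  then show ?case using Suc by simp
qed simp

text \<open>Crude but enough for the exponential series: the sum of all absolute entries dominates
  every row sum.\<close>

lemma matpow_entry_le: "\<bar>matpow A k $ i $ j\<bar> \<le> (\<Sum>i\<in>UNIV. \<Sum>j\<in>UNIV. \<bar>A $ i $ j\<bar>) ^ k"
proof (induction k arbitrary: i)
  case 0
  show ?case by (simp add: mat_def)
next
  case (Suc k)
  let ?c = "\<Sum>i\<in>UNIV. \<Sum>j\<in>UNIV. \<bar>A $ i $ j\<bar>"
  have "\<bar>matpow A (Suc k) $ i $ j\<bar> \<le> (\<Sum>l\<in>UNIV. \<bar>A $ i $ l * matpow A k $ l $ j\<bar>)"
    by (simp add: matrix_matrix_mult_def sum_abs)
  also have "\<dots> \<le> (\<Sum>l\<in>UNIV. \<bar>A $ i $ l\<bar> * ?c ^ k)"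
    unfolding abs_mult by (intro sum_mono mult_left_mono Suc) auto
  also have "\<dots> = (\<Sum>l\<in>UNIV. \<bar>A $ i $ l\<bar>) * ?c ^ k"
    by (simp add: sum_distrib_right)
  also have "\<dots> \<le> ?c * ?c ^ k"
    by (intro mult_right_mono member_le_sum[of i UNIV "\<lambda>i. \<Sum>l\<in>UNIV. \<bar>A $ i $ l\<bar>"])
       (auto intro!: sum_nonneg zero_le_power)
  finally show ?case by simp
qed

lemma summable_matpow_entry: "summable (\<lambda>k. matpow A k $ i $ j / fact k * s ^ k)"
proof (rule summable_comparison_test')
  let ?c = "\<Sum>i\<in>UNIV. \<Sum>j\<in>UNIV. \<bar>A $ i $ j\<bar>"
  show "summable (\<lambda>k. inverse (fact k) * (?c * \<bar>s\<bar>) ^ k)"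
    using summable_exp[of "?c * \<bar>s\<bar>"] by simp
  show "norm (matpow A k $ i $ j / fact k * s ^ k) \<le> inverse (fact k) * (?c * \<bar>s\<bar>) ^ k" for k
    using mult_right_mono[OF matpow_entry_le[of A k i j], of "\<bar>s\<bar> ^ k / fact k"]
    by (simp add: abs_mult power_abs power_mult_distrib divide_inverse mult_ac)
qed

lemma mat_exp_entry: "mat_exp (s *\<^sub>R A) $ i $ j = (\<Sum>k. matpow A k $ i $ j / fact k * s ^ k)"
proof -
  have "(\<lambda>k. (1 / fact k) *\<^sub>R matpow (s *\<^sub>R A) k) sums
    (\<chi> i j. \<Sum>k. matpow A k $ i $ j / fact k * s ^ k)"
    unfolding sums_def
  proof (intro vec_tendstoI)
    fix i j
    show "(\<lambda>n. (\<Sum>k<n. (1 / fact k) *\<^sub>R matpow (s *\<^sub>R A) k) $ i $ j) \<longlonglongrightarrow>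
       (\<chi> i j. \<Sum>k. matpow A k $ i $ j / fact k * s ^ k) $ i $ j"
      using summable_LIMSEQ[OF summable_matpow_entry[of A i j s]]
      by (simp add: matpow_scaleR mult.commute)
  qed
  then show ?thesis
    by (simp add: mat_exp_def sums_unique[symmetric])
qed

lemma mat_exp_0: "mat_exp 0 = (mat 1 :: real^'n^'n)"
proof -
  have "mat_exp (0 *\<^sub>R (mat 1 :: real^'n^'n)) $ i $ j = mat 1 $ i $ j" for i j :: "'n"
    unfolding mat_exp_entry powser_zero by simp
  then show ?thesis by (simp add: vec_eq_iff)
qed

text \<open>Termwise differentiation, where the shift in \<open>diffs\<close> cancels against the
  factorial. A stands on the right so that transposition puts it in front of the flow.\<close>

lemma mat_exp_entry_has_derivative:
  "((\<lambda>s. mat_exp (s *\<^sub>R A) $ i $ j) has_real_derivative (mat_exp (s *\<^sub>R A) ** A) $ i $ j) (at s)"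
proof -
  let ?c = "\<lambda>k. matpow A k $ i $ j / fact k"
  have "((\<lambda>s. \<Sum>k. ?c k * s ^ k) has_field_derivative (\<Sum>k. diffs ?c k * s ^ k)) (at s)"
    by (rule termdiffs_strong_converges_everywhere[OF summable_matpow_entry])
  moreover have "(\<Sum>k. diffs ?c k * s ^ k) = (\<Sum>k. \<Sum>l\<in>UNIV. matpow A k $ i $ l / fact k * s ^ k * A $ l $ j)"
  proof (rule suminf_cong)
    fix k
    have "diffs ?c k = (matpow A k ** A) $ i $ j / fact k"
      by (simp add: diffs_def matpow_commute del: of_nat_Suc)
    then show "diffs ?c k * s ^ k = (\<Sum>l\<in>UNIV. matpow A k $ i $ l / fact k * s ^ k * A $ l $ j)"
      by (simp add: matrix_matrix_mult_def sum_divide_distrib sum_distrib_left mult_ac)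
  qed
  also have "\<dots> = (\<Sum>l\<in>UNIV. \<Sum>k. matpow A k $ i $ l / fact k * s ^ k * A $ l $ j)"
    by (intro suminf_sum summable_mult2 summable_matpow_entry)
  also have "\<dots> = (mat_exp (s *\<^sub>R A) ** A) $ i $ j"
    unfolding suminf_mult2[OF summable_matpow_entry, symmetric] mat_exp_entry[symmetric]
    by (simp add: matrix_matrix_mult_def)
  finally show ?thesis
    using \<open>((\<lambda>s. \<Sum>k. ?c k * s ^ k) has_field_derivative _) (at s)\<close> by (simp add: mat_exp_entry)
qed

lemma transpose_mat_exp_has_vector_derivative:
  "((\<lambda>s. transpose (mat_exp (s *\<^sub>R A)) *v v) has_vector_derivative
    transpose A *v (transpose (mat_exp (s *\<^sub>R A)) *v v)) (at s)"
proof -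
  have "((\<lambda>s. (transpose (mat_exp (s *\<^sub>R A)) *v v) $ i) has_real_derivative
      (transpose A *v (transpose (mat_exp (s *\<^sub>R A)) *v v)) $ i) (at s)" for i
  proof -
    have "((\<lambda>s. \<Sum>j\<in>UNIV. mat_exp (s *\<^sub>R A) $ j $ i * v $ j) has_real_derivative
       (\<Sum>j\<in>UNIV. (mat_exp (s *\<^sub>R A) ** A) $ j $ i * v $ j)) (at s)"
      by (intro DERIV_sum DERIV_cmult_right mat_exp_entry_has_derivative)
    then show ?thesis
      unfolding matrix_vector_mul_assoc matrix_transpose_mul[symmetric]
      by (simp add: matrix_vector_mult_def transpose_def)
  qed
  then show ?thesis
    unfolding has_vector_derivative_def
    by (intro has_derivative_componentwise_within[THEN iffD2])
       (auto simp: Basis_vec_def inner_axis has_field_derivative_def mult.commute[of _ "_ $ _"])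
qed

lemma inner_sym_part: "x \<bullet> (sym_part C *v x) = x \<bullet> (transpose C *v x)"
  and sym_part_inner_commute: "x \<bullet> (sym_part C *v y) = y \<bullet> (sym_part C *v x)"
  and inner_transpose: "x \<bullet> (transpose C *v y) = (C *v x) \<bullet> y" for x y :: "real^'n" 
proof -
  show *: "x \<bullet> (transpose C *v y) = (C *v x) \<bullet> y" for x y :: "real^'n" and C :: "real^'n^'n"
    by (metis dot_lmul_matrix transpose_matrix_vector transpose_transpose inner_commute)
  have S: "x \<bullet> (sym_part C *v y) = (x \<bullet> (C *v y) + x \<bullet> (transpose C *v y)) / 2" for x y :: "real^'n"
    by (simp add: sym_part_def scaleR_matrix_vector_assoc[symmetric] matrix_vector_mult_add_rdistrib
        inner_add_right)
  show "x \<bullet> (sym_part C *v x) = x \<bullet> (transpose C *v x)"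
    unfolding S * by (simp add: inner_commute)
  show "x \<bullet> (sym_part C *v y) = y \<bullet> (sym_part C *v x)"
    unfolding S * by (simp add: inner_commute)
qed

text \<open>The squared norm has derivative 2 y . C_S y along the flow, because the antisymmetric
  part of C drops out of the quadratic form. With b = 0 the transpose of exp (- t C) is seen to be a
  contraction.\<close>

lemma transpose_mat_exp_mono:
  fixes C :: "real^'n^'n"
  assumes psd: "\<And>x. 0 \<le> x \<bullet> (sym_part C *v x)" and "a \<le> b"
  shows "norm (transpose (mat_exp (a *\<^sub>R C)) *v v) \<le> norm (transpose (mat_exp (b *\<^sub>R C)) *v v)"
proof -
  let ?\<xi> = "\<lambda>s. transpose (mat_exp (s *\<^sub>R C)) *v v"
  have "?\<xi> a \<bullet> ?\<xi> a \<le> ?\<xi> b \<bullet> ?\<xi> b"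
  proof (rule DERIV_nonneg_imp_nondecreasing[OF \<open>a \<le> b\<close>], intro exI conjI)
    fix s
    show "((\<lambda>s. ?\<xi> s \<bullet> ?\<xi> s) has_real_derivative 2 * (?\<xi> s \<bullet> (sym_part C *v ?\<xi> s))) (at s)"
      unfolding has_field_derivative_def
      by (rule has_derivative_eq_rhs, rule has_derivative_inner
          [OF transpose_mat_exp_has_vector_derivative[unfolded has_vector_derivative_def]
              transpose_mat_exp_has_vector_derivative[unfolded has_vector_derivative_def]])
         (simp add: fun_eq_iff inner_sym_part inner_commute)
    show "0 \<le> 2 * (?\<xi> s \<bullet> (sym_part C *v ?\<xi> s))"
      using psd by simp
  qed
  then show ?thesis
    by (simp add: norm_eq_sqrt_inner)
qed

section \<open>Cut off waves as test functions\<close>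

lemma mtrace_matrix_mult: "mtrace (A ** B) = (\<Sum>i\<in>UNIV. \<Sum>j\<in>UNIV. A $ i $ j * B $ j $ i)"
  by (simp add: mtrace_def matrix_matrix_mult_def)

definition outer :: "real^'n \<Rightarrow> real^'n \<Rightarrow> real^'n^'n" where
  "outer a b = (\<chi> i j. a $ i * b $ j)"

lemma outer_mult_vec: "outer a b *v h = (b \<bullet> h) *\<^sub>R a"
  by (simp add: outer_def matrix_vector_mult_def vec_eq_iff inner_vec_def sum_distrib_left mult_ac)

lemma
  shows mtrace_mult_add: "mtrace (A ** (B + D)) = mtrace (A ** B) + mtrace (A ** D)"
    and mtrace_mult_diff: "mtrace (A ** (B - D)) = mtrace (A ** B) - mtrace (A ** D)"
    and mtrace_mult_scaleR: "mtrace (A ** (c *\<^sub>R B)) = c * mtrace (A ** B)"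
    and mtrace_mult_outer: "mtrace (A ** outer a b) = b \<bullet> (A *v a)"
  by (simp_all add: mtrace_matrix_mult outer_def distrib_left right_diff_distrib sum.distrib
      sum_subtractf sum_distrib_left inner_vec_def matrix_vector_mult_def mult_ac)

text \<open>An exponent of at least 2 makes the difference quotient at the kink 0 of order |h|^(k +
  1); elsewhere the function is locally 0 or a power.\<close>

lemma max_0_power_has_derivative:
  "((\<lambda>s::real. max 0 s ^ Suc (Suc k)) has_real_derivative real (Suc (Suc k)) * max 0 s ^ Suc k) (at s)"
proof (cases s "0::real" rule: linorder_cases)
  case less
  have "((\<lambda>s. 0) has_real_derivative 0) (at s)"
    by simp
  then have "((\<lambda>s::real. max 0 s ^ Suc (Suc k)) has_real_derivative 0) (at s)"
    by (rule has_field_derivative_transform_within_open[of _ _ _ "{..<0}"]) (use less in auto)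
  then show ?thesis using less by simp
next
  case greater
  have "((\<lambda>s. s ^ Suc (Suc k)) has_real_derivative real (Suc (Suc k)) * s ^ Suc k) (at s)"
    using DERIV_pow[of "Suc (Suc k)" s] by simp
  then have "((\<lambda>s::real. max 0 s ^ Suc (Suc k)) has_real_derivative real (Suc (Suc k)) * s ^ Suc k) (at s)"
    by (rule has_field_derivative_transform_within_open[of _ _ _ "{0<..}"]) (use greater in auto)
  then show ?thesis using greater by simp
next
  case equal
  have "((\<lambda>h::real. max 0 h ^ Suc (Suc k) / h) \<longlongrightarrow> 0) (at 0)"
  proof (rule Lim_null_comparison)
    show "((\<lambda>h::real. \<bar>h\<bar> ^ Suc k) \<longlongrightarrow> 0) (at 0)"
      by (auto intro!: tendsto_eq_intros)
    show "\<forall>\<^sub>F h::real in at 0. norm (max 0 h ^ Suc (Suc k) / h) \<le> \<bar>h\<bar> ^ Suc k"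
      by (intro always_eventually) (auto simp: max_def abs_mult mult_nonpos_nonneg)
  qed
  then show ?thesis
    using equal by (simp add: DERIV_def)
qed

text \<open>The cube of the positive part is twice continuously differentiable, and the derivatives of
  \<open>bump \<epsilon> 3\<close> are \<open>\<epsilon>\<close> times functions of quadratic growth.\<close>

definition bump :: "real \<Rightarrow> nat \<Rightarrow> real^'n \<Rightarrow> real" where
  "bump \<epsilon> k x = max 0 (1 - \<epsilon> * (norm x)\<^sup>2) ^ k"

lemma bump_has_derivative:
  "((bump \<epsilon> (Suc (Suc k))) has_derivative
     (\<lambda>h. ((- 2 * \<epsilon> * real (Suc (Suc k)) * bump \<epsilon> (Suc k) x) *\<^sub>R x) \<bullet> h)) (at x)"
proof -
  have "((\<lambda>x. 1 - \<epsilon> * (x \<bullet> x)) has_derivative (\<lambda>h. - 2 * \<epsilon> * (x \<bullet> h))) (at x)"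
    by (auto intro!: derivative_eq_intros simp: inner_commute)
  then have "((\<lambda>x. 1 - \<epsilon> * (norm x)\<^sup>2) has_derivative (\<lambda>h. - 2 * \<epsilon> * (x \<bullet> h))) (at x)"
    by (simp add: power2_norm_eq_inner)
  from has_derivative_compose[OF this max_0_power_has_derivative[unfolded has_field_derivative_def]]
  show ?thesis
    unfolding bump_def[abs_def] by (rule has_derivative_eq_rhs) (simp add: fun_eq_iff mult_ac)
qed

lemma bump_nonneg: "0 \<le> bump \<epsilon> k x"
  by (simp add: bump_def)

lemma bump_le_1: "0 \<le> \<epsilon> \<Longrightarrow> bump \<epsilon> k x \<le> 1"
  unfolding bump_def by (intro power_le_one) auto

lemma continuous_on_bump [continuous_intros]: "continuous_on S (bump \<epsilon> k)"
  unfolding bump_def[abs_def] by (intro continuous_intros)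

lemma bump_measurable [measurable]: "bump \<epsilon> k \<in> borel_measurable borel"
  by (intro borel_measurable_continuous_onI continuous_intros)

text \<open>Bernoulli's inequality where \<open>\<epsilon> * (norm x)\<^sup>2\<close> is at most 1;
  beyond that its lower bound is negative anyway. The loss caused by the cutoff is thus linear in
  \<epsilon> at the price of quadratic growth in x.\<close>

lemma one_minus_bump_le:
  assumes "0 \<le> \<epsilon>"
  shows "\<bar>1 - bump \<epsilon> 3 x\<bar> \<le> 3 * \<epsilon> * (norm x)\<^sup>2"
proof -
  let ?s = "\<epsilon> * (norm x)\<^sup>2"
  have "1 - 3 * ?s \<le> bump \<epsilon> 3 x"
  proof (cases "?s \<le> 1")
    case True
    then show ?thesis
      using Bernoulli_inequality[of "- ?s" 3] by (simp add: bump_def)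
  qed (use bump_nonneg[of \<epsilon> 3 x] in linarith)
  then show ?thesis
    using bump_le_1[OF assms, of 3 x] by simp
qed

context
  fixes \<epsilon> \<theta> :: real and \<xi> :: "real^'n"
begin

text \<open>The factor exp (|\<xi>|^2 / 2) of \<open>wave\<close> is left out: it does not depend on
  x, and without it these functions are bounded by 1 for all frequencies when \<epsilon> is
  nonnegative.\<close>

definition cutoff_wave :: "real^'n \<Rightarrow> real" where
  "cutoff_wave x = bump \<epsilon> 3 x * cos (\<xi> \<bullet> x + \<theta>)"

definition bump_grad :: "real^'n \<Rightarrow> real^'n" where
  "bump_grad x = (- 6 * \<epsilon> * bump \<epsilon> 2 x) *\<^sub>R x"

definition cutoff_wave_grad :: "real^'n \<Rightarrow> real^'n" where
  "cutoff_wave_grad x = cos (\<xi> \<bullet> x + \<theta>) *\<^sub>R bump_grad x - (bump \<epsilon> 3 x * sin (\<xi> \<bullet> x + \<theta>)) *\<^sub>R \<xi>"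

text \<open>Product rule. Two derivatives on the bump give 24 as the product of -6, from the
  gradient of the cube, and -4, from that of the square. The sum of two outer products is the mixed
  term.\<close>

definition cutoff_wave_hess :: "real^'n \<Rightarrow> real^'n^'n" where
  "cutoff_wave_hess x =
     cos (\<xi> \<bullet> x + \<theta>) *\<^sub>R ((24 * \<epsilon>\<^sup>2 * bump \<epsilon> 1 x) *\<^sub>R outer x x - (6 * \<epsilon> * bump \<epsilon> 2 x) *\<^sub>R mat 1)
     - sin (\<xi> \<bullet> x + \<theta>) *\<^sub>R (outer (bump_grad x) \<xi> + outer \<xi> (bump_grad x))
     - (bump \<epsilon> 3 x * cos (\<xi> \<bullet> x + \<theta>)) *\<^sub>R outer \<xi> \<xi>"

lemma test_fun_cutoff_wave:
  assumes "0 < \<epsilon>"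
  shows "test_fun cutoff_wave cutoff_wave_grad cutoff_wave_hess"
  unfolding test_fun_def
proof (intro conjI allI)
  have b3: "(bump \<epsilon> 3 has_derivative (\<lambda>h. bump_grad x \<bullet> h)) (at x)" for x :: "real^'n"
    using bump_has_derivative[of \<epsilon> 1 x] by (simp add: bump_grad_def numeral_3_eq_3 numeral_2_eq_2)
  have b2: "(bump \<epsilon> 2 has_derivative (\<lambda>h. - 4 * \<epsilon> * bump \<epsilon> 1 x * (x \<bullet> h))) (at x)" for x :: "real^'n"
    using bump_has_derivative[of \<epsilon> 0 x] by (simp add: numeral_2_eq_2)
  have bg: "(bump_grad has_derivative
      (\<lambda>h. (24 * \<epsilon>\<^sup>2 * bump \<epsilon> 1 x * (x \<bullet> h)) *\<^sub>R x - (6 * \<epsilon> * bump \<epsilon> 2 x) *\<^sub>R h)) (at x)" for x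
    unfolding bump_grad_def[abs_def]
    by (auto intro!: derivative_eq_intros b2 simp: power2_eq_square mult_ac)
  show "(cutoff_wave has_derivative (\<lambda>h. cutoff_wave_grad x \<bullet> h)) (at x)" for x
    unfolding cutoff_wave_def[abs_def] cutoff_wave_grad_def
    by (auto intro!: derivative_eq_intros b3 simp: fun_eq_iff inner_diff_left mult_ac)
  show "(cutoff_wave_grad has_derivative (\<lambda>h. cutoff_wave_hess x *v h)) (at x)" for x
    unfolding cutoff_wave_grad_def[abs_def]
    by (rule has_derivative_eq_rhs, (rule derivative_eq_intros b3 bg refl)+)
       (simp add: fun_eq_iff cutoff_wave_hess_def matrix_vector_mult_diff_rdistrib
        matrix_vector_mult_add_rdistrib scaleR_matrix_vector_assoc[symmetric] outer_mult_vec
        algebra_simps)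
  show "continuous_on UNIV cutoff_wave_hess"
    unfolding cutoff_wave_hess_def[abs_def] outer_def bump_grad_def
    by (intro continuous_intros continuous_on_vec_lambda)
  have "{x. cutoff_wave x \<noteq> 0} \<subseteq> cball 0 (1 / sqrt \<epsilon>)"
  proof clarsimp
    fix x assume "cutoff_wave x \<noteq> 0"
    then have "\<epsilon> * (norm x)\<^sup>2 \<le> 1"
      by (auto simp: cutoff_wave_def bump_def max_def split: if_splits)
    then have "(norm x)\<^sup>2 \<le> (1 / sqrt \<epsilon>)\<^sup>2"
      using assms by (simp add: power_divide field_simps)
    then show "norm x \<le> 1 / sqrt \<epsilon>"
      by (rule power2_le_imp_le) (use assms in simp)
  qed
  then show "compact (closure {x. cutoff_wave x \<noteq> 0})"
    by (meson bounded_cball bounded_subset compact_closure)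
qed

text \<open>The first two summands are the decay and the drift of a wave, multiplied by the cutoff;
  in all others a derivative falls on the bump and brings a factor \<epsilon>. By symmetry of
  \<open>sym_part C\<close> the two mixed terms agree, whence 12 = 2 * 6.\<close>

lemma FP_adj_cutoff_wave:
  "FP_adj C cutoff_wave_grad cutoff_wave_hess x =
     - (\<xi> \<bullet> (sym_part C *v \<xi>)) * cutoff_wave x + bump \<epsilon> 3 x * sin (\<xi> \<bullet> x + \<theta>) * ((C *v x) \<bullet> \<xi>)
     + (cos (\<xi> \<bullet> x + \<theta>) * (24 * \<epsilon>\<^sup>2 * bump \<epsilon> 1 x * (x \<bullet> (sym_part C *v x))
          - 6 * \<epsilon> * bump \<epsilon> 2 x * mtrace (sym_part C) + 6 * \<epsilon> * bump \<epsilon> 2 x * ((C *v x) \<bullet> x))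
        + 12 * \<epsilon> * bump \<epsilon> 2 x * sin (\<xi> \<bullet> x + \<theta>) * (\<xi> \<bullet> (sym_part C *v x)))"
proof -
  have "mtrace (sym_part C ** cutoff_wave_hess x) =
      cos (\<xi> \<bullet> x + \<theta>) * (24 * \<epsilon>\<^sup>2 * bump \<epsilon> 1 x * (x \<bullet> (sym_part C *v x)) - 6 * \<epsilon> * bump \<epsilon> 2 x * mtrace (sym_part C))
      - sin (\<xi> \<bullet> x + \<theta>) * (2 * (\<xi> \<bullet> (sym_part C *v bump_grad x)))
      - bump \<epsilon> 3 x * cos (\<xi> \<bullet> x + \<theta>) * (\<xi> \<bullet> (sym_part C *v \<xi>))"
    using sym_part_inner_commute[of "bump_grad x" C \<xi>]
    by (simp add: cutoff_wave_hess_def mtrace_mult_add mtrace_mult_diff mtrace_mult_scaleR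
        mtrace_mult_outer mult_ac)
  moreover have "\<xi> \<bullet> (sym_part C *v bump_grad x) = - 6 * \<epsilon> * bump \<epsilon> 2 x * (\<xi> \<bullet> (sym_part C *v x))"
    unfolding bump_grad_def matrix_vector_mult_scaleR by simp
  moreover have "(C *v x) \<bullet> cutoff_wave_grad x =
      - 6 * \<epsilon> * bump \<epsilon> 2 x * cos (\<xi> \<bullet> x + \<theta>) * ((C *v x) \<bullet> x) - bump \<epsilon> 3 x * sin (\<xi> \<bullet> x + \<theta>) * ((C *v x) \<bullet> \<xi>)"
    by (simp add: cutoff_wave_grad_def bump_grad_def inner_diff_right)
  ultimately show ?thesis
    unfolding FP_adj_def cutoff_wave_def by (simp add: algebra_simps)
qed

end

section \<open>Duality for weak solutions\<close>

lemma H_norm_diff_commute: "H_norm (\<lambda>x. f x - g x) = H_norm (\<lambda>x. g x - f x)"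
proof -
  have "(f x - g x) * (f x - g x) = (g x - f x) * (g x - f x)" for x
    by (simp add: algebra_simps)
  then show ?thesis
    by (simp add: H_norm_def H_inner_def)
qed

lemma H_pairing_diff_le:
  assumes "in_H f" "in_H g" "L2_gauss \<phi>"
  shows "\<bar>(LINT x|lborel. f x * \<phi> x) - (LINT x|lborel. g x * \<phi> x)\<bar>
    \<le> H_norm (\<lambda>x. f x - g x) * gauss_norm \<phi>"
proof -
  have "(LINT x|lborel. f x * \<phi> x) - (LINT x|lborel. g x * \<phi> x) = (LINT x|lborel. (f x - g x) * \<phi> x)"
    using assms by (simp add: left_diff_distrib integrable_H_mult)
  then show ?thesis
    using H_Cauchy_Schwarz[OF in_H_diff[OF assms(1,2)] assms(3)] by simp
qed

abbreviation quad_weight :: "real^'n \<Rightarrow> real" where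
  "quad_weight x \<equiv> 1 + (norm x)\<^sup>2"

lemma norm_le_quad_weight: "norm x \<le> quad_weight x"
  using zero_le_power2[of "norm x - 1 / 2"] by (simp add: power2_diff power_divide)

lemma H_pairing_has_derivative:
  fixes f u :: "real \<Rightarrow> real^'n \<Rightarrow> real"
  assumes f: "\<And>s. 0 \<le> s \<Longrightarrow> in_H (f s)" and "0 \<le> \<tau>"
    and cont: "((\<lambda>\<sigma>. H_norm (\<lambda>x. f \<sigma> x - f \<tau> x)) \<longlongrightarrow> 0) (at \<tau> within {0..})"
    and D: "((\<lambda>\<sigma>. LINT x|lborel. f \<sigma> x * u \<tau> x) has_real_derivative D) (at \<tau> within {0..})"
    and u: "\<And>\<sigma>. L2_gauss (u \<sigma>)" and u': "L2_gauss u'"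
    and e: "\<And>\<sigma> x. \<bar>u \<sigma> x - u \<tau> x - (\<sigma> - \<tau>) * u' x\<bar> \<le> e \<sigma> * quad_weight x"
    and e_lim: "((\<lambda>\<sigma>. e \<sigma> / \<bar>\<sigma> - \<tau>\<bar>) \<longlongrightarrow> 0) (at \<tau> within {0..})"
  shows "((\<lambda>\<sigma>. LINT x|lborel. f \<sigma> x * u \<sigma> x) has_real_derivative
    (D + (LINT x|lborel. f \<tau> x * u' x))) (at \<tau> within {0..})"
proof -
  let ?r = "\<lambda>\<sigma> x. u \<sigma> x - u \<tau> x - (\<sigma> - \<tau>) * u' x"
  let ?G = "gauss_norm (quad_weight :: real^'n \<Rightarrow> real)"
  have [measurable]: "u \<sigma> \<in> borel_measurable borel" "u' \<in> borel_measurable borel" for \<sigma>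
    using u u' by (simp_all add: L2_gauss_def)
  have r: "L2_gauss (?r \<sigma>)" "gauss_norm (?r \<sigma>) \<le> e \<sigma> * ?G" for \<sigma>
    by (rule L2_gauss_bound[OF _ e], measurable)+
  have ev: "\<forall>\<^sub>F \<sigma> in at \<tau> within {0..}. 0 \<le> \<sigma> \<and> \<sigma> \<noteq> \<tau>"
    by (auto simp: eventually_at_filter)
  have split: "((LINT x|lborel. f \<sigma> x * u \<sigma> x) - (LINT x|lborel. f \<tau> x * u \<tau> x)) / (\<sigma> - \<tau>) =
      ((LINT x|lborel. f \<sigma> x * u \<tau> x) - (LINT x|lborel. f \<tau> x * u \<tau> x)) / (\<sigma> - \<tau>)
      + (LINT x|lborel. f \<sigma> x * u' x) + (LINT x|lborel. f \<sigma> x * ?r \<sigma> x) / (\<sigma> - \<tau>)"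
    if "0 \<le> \<sigma>" "\<sigma> \<noteq> \<tau>" for \<sigma>
  proof -
    have "f \<sigma> x * u \<sigma> x = f \<sigma> x * u \<tau> x + (\<sigma> - \<tau>) * (f \<sigma> x * u' x) + f \<sigma> x * ?r \<sigma> x" for x
      by (simp add: algebra_simps)
    then have "(LINT x|lborel. f \<sigma> x * u \<sigma> x) =
        (LINT x|lborel. f \<sigma> x * u \<tau> x + (\<sigma> - \<tau>) * (f \<sigma> x * u' x) + f \<sigma> x * ?r \<sigma> x)"
      by simp
    also have "\<dots> = (LINT x|lborel. f \<sigma> x * u \<tau> x) + (\<sigma> - \<tau>) * (LINT x|lborel. f \<sigma> x * u' x)
        + (LINT x|lborel. f \<sigma> x * ?r \<sigma> x)"
      using integrable_H_mult[OF f[OF that(1)] u[of \<tau>]] integrable_H_mult[OF f[OF that(1)] u']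
        integrable_H_mult[OF f[OF that(1)] r(1)[of \<sigma>]]
      by (subst Bochner_Integration.integral_add Bochner_Integration.integral_add[of _ "\<lambda>x. f \<sigma> x * u \<tau> x"]; simp)+
    finally have eq: "(LINT x|lborel. f \<sigma> x * u \<sigma> x) = (LINT x|lborel. f \<sigma> x * u \<tau> x)
        + (\<sigma> - \<tau>) * (LINT x|lborel. f \<sigma> x * u' x) + (LINT x|lborel. f \<sigma> x * ?r \<sigma> x)" .
    have "(a + d * b + c - n) / d = (a - n) / d + b + c / d" if "d \<noteq> 0" for a b c d n :: real
      using that by (simp add: field_simps)
    then show ?thesis
      unfolding eq using that(2) by simp
  qed
  have "((\<lambda>\<sigma>. LINT x|lborel. f \<sigma> x * u' x) \<longlongrightarrow> (LINT x|lborel. f \<tau> x * u' x)) (at \<tau> within {0..})"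
  proof (rule Lim_null[THEN iffD2], rule Lim_null_comparison)
    show "\<forall>\<^sub>F \<sigma> in at \<tau> within {0..}. norm ((LINT x|lborel. f \<sigma> x * u' x) - (LINT x|lborel. f \<tau> x * u' x))
        \<le> H_norm (\<lambda>x. f \<sigma> x - f \<tau> x) * gauss_norm u'"
      using ev by eventually_elim (use f \<open>0 \<le> \<tau>\<close> u' in \<open>auto intro!: H_pairing_diff_le\<close>)
    show "((\<lambda>\<sigma>. H_norm (\<lambda>x. f \<sigma> x - f \<tau> x) * gauss_norm u') \<longlongrightarrow> 0) (at \<tau> within {0..})"
      using tendsto_mult[OF cont tendsto_const, of "gauss_norm u'"] by simp
  qed
  moreover have "((\<lambda>\<sigma>. (LINT x|lborel. f \<sigma> x * ?r \<sigma> x) / (\<sigma> - \<tau>)) \<longlongrightarrow> 0) (at \<tau> within {0..})"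
  proof (rule Lim_null_comparison)
    show "\<forall>\<^sub>F \<sigma> in at \<tau> within {0..}. norm ((LINT x|lborel. f \<sigma> x * ?r \<sigma> x) / (\<sigma> - \<tau>))
        \<le> (H_norm (f \<tau>) + H_norm (\<lambda>x. f \<sigma> x - f \<tau> x)) * (e \<sigma> / \<bar>\<sigma> - \<tau>\<bar> * ?G)"
      using ev
    proof eventually_elim
      case (elim \<sigma>)
      then have "\<bar>LINT x|lborel. f \<sigma> x * ?r \<sigma> x\<bar> \<le> H_norm (f \<sigma>) * gauss_norm (?r \<sigma>)"
        by (intro H_Cauchy_Schwarz f r) auto
      also have "\<dots> \<le> (H_norm (f \<tau>) + H_norm (\<lambda>x. f \<sigma> x - f \<tau> x)) * (e \<sigma> * ?G)"
        using elim \<open>0 \<le> \<tau>\<close> by (intro mult_mono H_norm_triangle f r) (auto intro: add_nonneg_nonneg)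
      finally show ?case
        by (auto simp: divide_right_mono mult_ac dest: divide_right_mono[of _ _ "\<bar>\<sigma> - \<tau>\<bar>"])
    qed
    show "((\<lambda>\<sigma>. (H_norm (f \<tau>) + H_norm (\<lambda>x. f \<sigma> x - f \<tau> x)) * (e \<sigma> / \<bar>\<sigma> - \<tau>\<bar> * ?G)) \<longlongrightarrow> 0)
        (at \<tau> within {0..})"
      using tendsto_mult[OF tendsto_add[OF tendsto_const cont] tendsto_mult[OF e_lim tendsto_const],
          of "H_norm (f \<tau>)" ?G] by simp
  qed
  ultimately have "((\<lambda>\<sigma>. ((LINT x|lborel. f \<sigma> x * u \<tau> x) - (LINT x|lborel. f \<tau> x * u \<tau> x)) / (\<sigma> - \<tau>)
      + (LINT x|lborel. f \<sigma> x * u' x) + (LINT x|lborel. f \<sigma> x * ?r \<sigma> x) / (\<sigma> - \<tau>)) \<longlongrightarrow>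
      D + (LINT x|lborel. f \<tau> x * u' x) + 0) (at \<tau> within {0..})"
    using D unfolding has_field_derivative_iff by (intro tendsto_add)
  then show ?thesis
    unfolding has_field_derivative_iff add_0_right
    by (rule Lim_transform_eventually) (use ev split in \<open>auto elim!: eventually_mono\<close>)
qed

section \<open>Cut off waves along the adjoint flow\<close>

lemma cos_Taylor: "\<bar>cos a - cos b + sin b * (a - b)\<bar> \<le> (a - b)\<^sup>2" for a b :: real
proof -
  define d where "d = a - b"
  have s: "\<bar>sin d - d\<bar> \<le> d\<^sup>2 / 2"
  proof -
    have "(\<Sum>m<2. sin_coeff m * d ^ m) = d"
      by (simp add: numeral_2_eq_2 sin_coeff_def)
    then show ?thesis
      using Maclaurin_sin_bound[of d 2] by (simp add: fact_2)
  qed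
  have "1 - cos d = 2 * (sin (d / 2))\<^sup>2"
    using cos_double_sin[of "d / 2"] by simp
  also have "\<dots> \<le> 2 * (d / 2)\<^sup>2"
    by (intro mult_left_mono abs_le_square_iff[THEN iffD1] abs_sin_x_le_abs_x) auto
  finally have c: "\<bar>cos d - 1\<bar> \<le> d\<^sup>2 / 2"
    by (simp add: power_divide)
  have "cos a - cos b + sin b * (a - b) = cos b * (cos d - 1) - sin b * (sin d - d)"
    using cos_add[of b d] unfolding d_def[symmetric] by (simp add: d_def algebra_simps)
  also have "\<bar>\<dots>\<bar> \<le> \<bar>cos b\<bar> * \<bar>cos d - 1\<bar> + \<bar>sin b\<bar> * \<bar>sin d - d\<bar>"
    by (metis abs_mult abs_triangle_ineq4)
  also have "\<dots> \<le> 1 * (d\<^sup>2 / 2) + 1 * (d\<^sup>2 / 2)"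
    by (intro add_mono mult_mono c s) auto
  finally show ?thesis by (simp add: d_def)
qed

definition cutoff_error :: "real^'n^'n \<Rightarrow> real \<Rightarrow> real \<Rightarrow> real^'n \<Rightarrow> real^'n \<Rightarrow> real" where
  "cutoff_error C \<epsilon> \<theta> \<xi> x =
     cos (\<xi> \<bullet> x + \<theta>) * (24 * \<epsilon>\<^sup>2 * bump \<epsilon> 1 x * (x \<bullet> (sym_part C *v x))
          - 6 * \<epsilon> * bump \<epsilon> 2 x * mtrace (sym_part C) + 6 * \<epsilon> * bump \<epsilon> 2 x * ((C *v x) \<bullet> x))
        + 12 * \<epsilon> * bump \<epsilon> 2 x * sin (\<xi> \<bullet> x + \<theta>) * (\<xi> \<bullet> (sym_part C *v x))"

text \<open>The coefficients are those of \<open>cutoff_error\<close>, with its quadratic forms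
  bounded by operator norms. Since the frequency enters only through a bound r, the constant serves
  a whole bounded curve of frequencies.\<close>

definition error_const :: "real^'n^'n \<Rightarrow> real \<Rightarrow> real" where
  "error_const C r = 24 * onorm ((*v) (sym_part C)) + 6 * \<bar>mtrace (sym_part C)\<bar> + 6 * onorm ((*v) C)
     + 12 * r * onorm ((*v) (sym_part C))"

lemma matrix_vector_mult_measurable [measurable]: "(\<lambda>x. A *v x) \<in> borel_measurable borel"
  for A :: "real^'n^'n"
  by (intro borel_measurable_continuous_onI linear_continuous_on matrix_vector_mul_bounded_linear)

lemma cutoff_error_measurable [measurable]: "cutoff_error C \<epsilon> \<theta> \<xi> \<in> borel_measurable borel"
  unfolding cutoff_error_def[abs_def] by measurable

lemma abs_inner_matrix_le:
  fixes A :: "real^'n^'n"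
  shows "\<bar>y \<bullet> (A *v x)\<bar> \<le> onorm ((*v) A) * norm y * norm x"
proof -
  have "\<bar>y \<bullet> (A *v x)\<bar> \<le> norm y * norm (A *v x)"
    by (rule Cauchy_Schwarz_ineq2)
  also have "\<dots> \<le> norm y * (onorm ((*v) A) * norm x)"
    by (intro mult_left_mono onorm matrix_vector_mul_bounded_linear) auto
  finally show ?thesis by (simp add: mult_ac)
qed

lemma abs_cutoff_error_le:
  fixes C :: "real^'n^'n"
  assumes \<epsilon>: "0 < \<epsilon>" "\<epsilon> \<le> 1" and r: "norm \<xi> \<le> r"
  shows "\<bar>cutoff_error C \<epsilon> \<theta> \<xi> x\<bar> \<le> \<epsilon> * error_const C r * quad_weight x"
proof -
  let ?S = "sym_part C" and ?q = "quad_weight x"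
  have pos: "0 \<le> onorm ((*v) ?S)" "0 \<le> onorm ((*v) C)"
    by (simp_all add: onorm_pos_le)
  have b: "\<bar>bump \<epsilon> k x\<bar> \<le> 1" for k
    using bump_nonneg[of \<epsilon> k x] bump_le_1[of \<epsilon> k x] \<epsilon> by simp
  have q: "norm x * norm x \<le> ?q" "norm x \<le> ?q" "1 \<le> ?q"
    using norm_le_quad_weight[of x] by (simp_all add: power2_eq_square)
  have 1: "\<bar>x \<bullet> (?S *v x)\<bar> \<le> onorm ((*v) ?S) * ?q"
    using abs_inner_matrix_le[of x ?S x] mult_left_mono[OF q(1) pos(1)] by (simp add: mult.assoc)
  have 2: "\<bar>(C *v x) \<bullet> x\<bar> \<le> onorm ((*v) C) * ?q"
    using abs_inner_matrix_le[of x C x] mult_left_mono[OF q(1) pos(2)] by (simp add: mult.assoc inner_commute)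
  have 3: "\<bar>\<xi> \<bullet> (?S *v x)\<bar> \<le> r * onorm ((*v) ?S) * ?q"
  proof -
    have "\<bar>\<xi> \<bullet> (?S *v x)\<bar> \<le> onorm ((*v) ?S) * norm \<xi> * norm x"
      by (rule abs_inner_matrix_le)
    also have "\<dots> \<le> onorm ((*v) ?S) * r * ?q"
      using r order_trans[OF norm_ge_zero r] by (intro mult_mono q pos) (auto intro!: mult_nonneg_nonneg pos)
    finally show ?thesis by (simp add: mult_ac)
  qed
  have 4: "\<bar>mtrace ?S\<bar> \<le> \<bar>mtrace ?S\<bar> * ?q"
    using mult_left_mono[OF q(3), of "\<bar>mtrace ?S\<bar>"] by simp
  have summand_le: "\<bar>k * a * b * y\<bar> \<le> k * \<epsilon> * z"
    if "0 \<le> k" "\<bar>a\<bar> \<le> \<epsilon>" "\<bar>b\<bar> \<le> 1" "\<bar>y\<bar> \<le> z" for k a b y z :: real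
  proof -
    have "\<bar>k * a * b * y\<bar> = k * (\<bar>a\<bar> * \<bar>b\<bar> * \<bar>y\<bar>)"
      using that(1) by (simp add: abs_mult mult_ac)
    also have "\<dots> \<le> k * (\<epsilon> * 1 * z)"
      using that \<epsilon> by (intro mult_left_mono mult_mono) auto
    finally show ?thesis by (simp add: mult_ac)
  qed
  have sc: "\<bar>bump \<epsilon> k x * cos (\<xi> \<bullet> x + \<theta>)\<bar> \<le> 1" "\<bar>bump \<epsilon> k x * sin (\<xi> \<bullet> x + \<theta>)\<bar> \<le> 1" for k
    unfolding abs_mult by (auto intro!: mult_le_one b)
  \<comment> \<open>The restriction of \<epsilon> to at most 1 lets the term of order \<epsilon>^2
    be absorbed into the common factor \<epsilon>.\<close>
  have eps: "\<bar>\<epsilon>\<^sup>2\<bar> \<le> \<epsilon>" "\<bar>\<epsilon>\<bar> \<le> \<epsilon>"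
    using \<epsilon> mult_left_le[of \<epsilon> \<epsilon>] by (auto simp: power2_eq_square)
  have eq: "cutoff_error C \<epsilon> \<theta> \<xi> x =
      24 * \<epsilon>\<^sup>2 * (bump \<epsilon> 1 x * cos (\<xi> \<bullet> x + \<theta>)) * (x \<bullet> (?S *v x))
      - 6 * \<epsilon> * (bump \<epsilon> 2 x * cos (\<xi> \<bullet> x + \<theta>)) * mtrace ?S
      + 6 * \<epsilon> * (bump \<epsilon> 2 x * cos (\<xi> \<bullet> x + \<theta>)) * ((C *v x) \<bullet> x)
      + 12 * \<epsilon> * (bump \<epsilon> 2 x * sin (\<xi> \<bullet> x + \<theta>)) * (\<xi> \<bullet> (?S *v x))"
    unfolding cutoff_error_def by (simp add: algebra_simps)
  have "\<bar>cutoff_error C \<epsilon> \<theta> \<xi> x\<bar> \<le> 24 * \<epsilon> * (onorm ((*v) ?S) * ?q) + 6 * \<epsilon> * (\<bar>mtrace ?S\<bar> * ?q)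
      + 6 * \<epsilon> * (onorm ((*v) C) * ?q) + 12 * \<epsilon> * (r * onorm ((*v) ?S) * ?q)"
    unfolding eq
    using summand_le[OF _ eps(1) sc(1)[of 1] 1, of 24] summand_le[OF _ eps(2) sc(1)[of 2] 4, of 6]
      summand_le[OF _ eps(2) sc(1)[of 2] 2, of 6] summand_le[OF _ eps(2) sc(2)[of 2] 3, of 12]
    by linarith
  also have "\<dots> = \<epsilon> * error_const C r * ?q"
    unfolding error_const_def by (simp add: algebra_simps)
  finally show ?thesis .
qed

lemma FP_adj_cutoff_wave_eq:
  "FP_adj C (cutoff_wave_grad \<epsilon> \<theta> \<xi>) (cutoff_wave_hess \<epsilon> \<theta> \<xi>) x =
     - (\<xi> \<bullet> (sym_part C *v \<xi>)) * cutoff_wave \<epsilon> \<theta> \<xi> x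
     + bump \<epsilon> 3 x * sin (\<xi> \<bullet> x + \<theta>) * ((C *v x) \<bullet> \<xi>) + cutoff_error C \<epsilon> \<theta> \<xi> x"
  unfolding FP_adj_cutoff_wave cutoff_error_def by simp

lemma cutoff_wave_measurable [measurable]: "cutoff_wave \<epsilon> \<theta> \<xi> \<in> borel_measurable borel"
  unfolding cutoff_wave_def[abs_def] by measurable

lemma abs_cutoff_wave_le: "0 \<le> \<epsilon> \<Longrightarrow> \<bar>cutoff_wave \<epsilon> \<theta> \<xi> x\<bar> \<le> 1"
  unfolding cutoff_wave_def abs_mult using bump_nonneg[of \<epsilon> 3 x] bump_le_1[of \<epsilon> 3 x]
  by (intro mult_le_one) auto

text \<open>The phase changes at rate (C x) . \<xi>, so the time derivative \<open>?u'\<close> of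
  the test function is exactly the negative of the drift term in
  \<open>FP_adj_cutoff_wave_eq\<close>. The decay term and the cutoff error survive.\<close>

lemma cutoff_wave_pairing_has_derivative:
  fixes C :: "real^'n^'n" and \<xi> :: "real \<Rightarrow> real^'n"
  assumes sol: "FP_solution C f0 f" and \<epsilon>: "0 < \<epsilon>" "\<epsilon> \<le> 1" and "0 \<le> \<tau>"
    and \<xi>: "(\<xi> has_vector_derivative transpose C *v \<xi> \<tau>) (at \<tau>)"
  shows "((\<lambda>\<sigma>. LINT x|lborel. f \<sigma> x * cutoff_wave \<epsilon> \<theta> (\<xi> \<sigma>) x) has_real_derivative
    (LINT x|lborel. f \<tau> x * cutoff_error C \<epsilon> \<theta> (\<xi> \<tau>) x)
      - (\<xi> \<tau> \<bullet> (sym_part C *v \<xi> \<tau>)) * (LINT x|lborel. f \<tau> x * cutoff_wave \<epsilon> \<theta> (\<xi> \<tau>) x))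
    (at \<tau> within {0..})"
proof -
  let ?u = "\<lambda>\<sigma>. cutoff_wave \<epsilon> \<theta> (\<xi> \<sigma>)"
  let ?u' = "\<lambda>x. - (bump \<epsilon> 3 x * sin (\<xi> \<tau> \<bullet> x + \<theta>) * ((C *v x) \<bullet> \<xi> \<tau>))"
  \<comment> \<open>The quadratic remainder from \<open>cos_Taylor\<close> plus the defect of
    linearizing the frequency curve; both are o(|\<sigma> - \<tau>|).\<close>
  let ?e = "\<lambda>\<sigma>. (norm (\<xi> \<sigma> - \<xi> \<tau>))\<^sup>2 + norm (\<xi> \<sigma> - \<xi> \<tau> - (\<sigma> - \<tau>) *\<^sub>R (transpose C *v \<xi> \<tau>))"
  let ?A = "FP_adj C (cutoff_wave_grad \<epsilon> \<theta> (\<xi> \<tau>)) (cutoff_wave_hess \<epsilon> \<theta> (\<xi> \<tau>))"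
  let ?a = "\<xi> \<tau> \<bullet> (sym_part C *v \<xi> \<tau>)"
  have f: "\<And>s. 0 \<le> s \<Longrightarrow> in_H (f s)"
    and cont: "((\<lambda>\<sigma>. H_norm (\<lambda>x. f \<sigma> x - f \<tau> x)) \<longlongrightarrow> 0) (at \<tau> within {0..})"
    and D: "((\<lambda>\<sigma>. LINT x|lborel. f \<sigma> x * ?u \<tau> x) has_real_derivative (LINT x|lborel. f \<tau> x * ?A x))
      (at \<tau> within {0..})"
    using sol \<open>0 \<le> \<tau>\<close> test_fun_cutoff_wave[OF \<epsilon>(1)] unfolding FP_solution_def by blast+
  have b: "\<bar>bump \<epsilon> k x\<bar> \<le> 1" for k and x :: "real^'n"
    using bump_nonneg[of \<epsilon> k x] bump_le_1[of \<epsilon> k x] \<epsilon> by simp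
  have u: "L2_gauss (?u \<sigma>)" for \<sigma>
    using \<epsilon> by (intro L2_gauss_bounded[OF cutoff_wave_measurable abs_cutoff_wave_le]) auto
  have err: "L2_gauss (cutoff_error C \<epsilon> \<theta> (\<xi> \<tau>))"
    by (rule L2_gauss_bound[OF cutoff_error_measurable abs_cutoff_error_le[OF \<epsilon> order_refl]])
  have u': "L2_gauss ?u'"
  proof (rule L2_gauss_bound)
    show "\<bar>?u' x\<bar> \<le> (norm (\<xi> \<tau>) * onorm ((*v) C)) * quad_weight x" for x
    proof -
      have "\<bar>?u' x\<bar> \<le> 1 * 1 * \<bar>\<xi> \<tau> \<bullet> (C *v x)\<bar>"
        unfolding abs_minus_cancel abs_mult inner_commute[of _ "\<xi> \<tau>"] by (intro mult_mono b) auto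
      also have "\<dots> \<le> onorm ((*v) C) * norm (\<xi> \<tau>) * norm x"
        using abs_inner_matrix_le[of "\<xi> \<tau>" C x] by simp
      also have "\<dots> \<le> onorm ((*v) C) * norm (\<xi> \<tau>) * quad_weight x"
        by (intro mult_left_mono norm_le_quad_weight mult_nonneg_nonneg onorm_pos_le) auto
      finally show ?thesis by (simp add: mult_ac)
    qed
  qed measurable
  have e: "\<bar>?u \<sigma> x - ?u \<tau> x - (\<sigma> - \<tau>) * ?u' x\<bar> \<le> ?e \<sigma> * quad_weight x" for \<sigma> x
  proof -
    let ?p = "\<xi> \<sigma> \<bullet> x + \<theta>" and ?q = "\<xi> \<tau> \<bullet> x + \<theta>"
    let ?d = "\<xi> \<sigma> - \<xi> \<tau> - (\<sigma> - \<tau>) *\<^sub>R (transpose C *v \<xi> \<tau>)"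
    have pq: "?p - ?q = (\<xi> \<sigma> - \<xi> \<tau>) \<bullet> x"
      by (simp add: inner_diff_left)
    have d: "?d \<bullet> x = (?p - ?q) - (\<sigma> - \<tau>) * ((C *v x) \<bullet> \<xi> \<tau>)"
      using inner_transpose[of x C "\<xi> \<tau>"] unfolding inner_diff_left inner_scaleR_left
      by (simp only: inner_commute[of _ x])
    have "?u \<sigma> x - ?u \<tau> x - (\<sigma> - \<tau>) * ?u' x =
        bump \<epsilon> 3 x * ((cos ?p - cos ?q + sin ?q * (?p - ?q)) - sin ?q * (?d \<bullet> x))"
      unfolding d cutoff_wave_def by (simp add: algebra_simps)
    also have "\<bar>\<dots>\<bar> \<le> 1 * ((?p - ?q)\<^sup>2 + 1 * (norm ?d * norm x))"
      unfolding abs_mult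
    proof (intro mult_mono b order_trans[OF abs_triangle_ineq4] add_mono cos_Taylor)
      show "\<bar>sin ?q * (?d \<bullet> x)\<bar> \<le> 1 * (norm ?d * norm x)"
        unfolding abs_mult by (intro mult_mono Cauchy_Schwarz_ineq2) auto
    qed auto
    also have "\<dots> \<le> (norm (\<xi> \<sigma> - \<xi> \<tau>))\<^sup>2 * quad_weight x + norm ?d * quad_weight x"
    proof -
      have "(?p - ?q)\<^sup>2 \<le> (norm (\<xi> \<sigma> - \<xi> \<tau>))\<^sup>2 * (norm x)\<^sup>2"
        unfolding pq power_mult_distrib[symmetric]
        using power_mono[OF Cauchy_Schwarz_ineq2[of "\<xi> \<sigma> - \<xi> \<tau>" x] abs_ge_zero, of 2] by simp
      also have "\<dots> \<le> (norm (\<xi> \<sigma> - \<xi> \<tau>))\<^sup>2 * quad_weight x"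
        by (intro mult_left_mono) auto
      finally show ?thesis
        using mult_left_mono[OF norm_le_quad_weight[of x] norm_ge_zero[of ?d]] by simp
    qed
    finally show ?thesis by (simp add: distrib_right)
  qed
  have quot: "((\<lambda>\<sigma>. norm (\<xi> \<sigma> - \<xi> \<tau> - (\<sigma> - \<tau>) *\<^sub>R (transpose C *v \<xi> \<tau>)) / \<bar>\<sigma> - \<tau>\<bar>) \<longlongrightarrow> 0)
      (at \<tau> within {0..})"
  proof -
    have "(\<xi> has_derivative (\<lambda>h. h *\<^sub>R (transpose C *v \<xi> \<tau>))) (at \<tau> within {0..})"
      using \<xi> unfolding has_vector_derivative_def by (rule has_derivative_at_withinI)
    then show ?thesis
      unfolding has_derivative_iff_norm by simp
  qed
  have lin: "((\<lambda>\<sigma>. norm (\<xi> \<sigma> - \<xi> \<tau>)) \<longlongrightarrow> 0) (at \<tau> within {0..})"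
    using has_vector_derivative_continuous[OF \<xi>] continuous_at_imp_continuous_at_within[of \<tau> \<xi> "{0..}"]
    by (intro tendsto_norm_zero LIM_zero) (simp add: continuous_within)
  \<comment> \<open>The squared increment over the time step: one increment tends to 0, while the
    quotient is bounded by the speed plus a term tending to 0.\<close>
  have "((\<lambda>\<sigma>. norm (\<xi> \<sigma> - \<xi> \<tau>) * (norm (\<xi> \<sigma> - \<xi> \<tau>) / \<bar>\<sigma> - \<tau>\<bar>)) \<longlongrightarrow> 0) (at \<tau> within {0..})"
  proof (rule Lim_null_comparison)
    let ?r = "\<lambda>\<sigma>. norm (\<xi> \<sigma> - \<xi> \<tau> - (\<sigma> - \<tau>) *\<^sub>R (transpose C *v \<xi> \<tau>)) / \<bar>\<sigma> - \<tau>\<bar>"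
    let ?v = "norm (transpose C *v \<xi> \<tau>)"
    show "((\<lambda>\<sigma>. norm (\<xi> \<sigma> - \<xi> \<tau>) * (?r \<sigma> + ?v)) \<longlongrightarrow> 0) (at \<tau> within {0..})"
      using tendsto_mult[OF lin tendsto_add[OF quot tendsto_const]] by simp
    have "norm (\<xi> \<sigma> - \<xi> \<tau>) / \<bar>\<sigma> - \<tau>\<bar> \<le> ?r \<sigma> + ?v" for \<sigma>
    proof -
      have "norm (\<xi> \<sigma> - \<xi> \<tau>) \<le>
          norm (\<xi> \<sigma> - \<xi> \<tau> - (\<sigma> - \<tau>) *\<^sub>R (transpose C *v \<xi> \<tau>)) + \<bar>\<sigma> - \<tau>\<bar> * ?v"
        using norm_triangle_sub[of "\<xi> \<sigma> - \<xi> \<tau>" "(\<sigma> - \<tau>) *\<^sub>R (transpose C *v \<xi> \<tau>)"] by simp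
      from divide_right_mono[OF this, of "\<bar>\<sigma> - \<tau>\<bar>"] show ?thesis
        by (cases "\<sigma> = \<tau>") (auto simp: add_divide_distrib)
    qed
    then show "\<forall>\<^sub>F \<sigma> in at \<tau> within {0..}. norm (norm (\<xi> \<sigma> - \<xi> \<tau>) * (norm (\<xi> \<sigma> - \<xi> \<tau>) / \<bar>\<sigma> - \<tau>\<bar>))
        \<le> norm (\<xi> \<sigma> - \<xi> \<tau>) * (?r \<sigma> + ?v)"
      by (intro always_eventually allI) (simp add: mult_left_mono del: times_divide_eq_right)
  qed
  from tendsto_add[OF this quot]
  have e_lim: "((\<lambda>\<sigma>. ?e \<sigma> / \<bar>\<sigma> - \<tau>\<bar>) \<longlongrightarrow> 0) (at \<tau> within {0..})"
    by (simp add: add_divide_distrib power2_eq_square)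
  have A: "?A x = - ?a * ?u \<tau> x - ?u' x + cutoff_error C \<epsilon> \<theta> (\<xi> \<tau>) x" for x
    unfolding FP_adj_cutoff_wave_eq by simp
  note int = integrable_H_mult[OF f[OF \<open>0 \<le> \<tau>\<close>]]
  have "(LINT x|lborel. f \<tau> x * ?A x) =
      (LINT x|lborel. - ?a * (f \<tau> x * ?u \<tau> x) - f \<tau> x * ?u' x + f \<tau> x * cutoff_error C \<epsilon> \<theta> (\<xi> \<tau>) x)"
    unfolding A by (intro Bochner_Integration.integral_cong refl) (simp add: algebra_simps)
  also have "\<dots> = - ?a * (LINT x|lborel. f \<tau> x * ?u \<tau> x) - (LINT x|lborel. f \<tau> x * ?u' x)
      + (LINT x|lborel. f \<tau> x * cutoff_error C \<epsilon> \<theta> (\<xi> \<tau>) x)"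
    using int[OF u[of \<tau>]] int[OF u'] int[OF err]
    by (simp only: Bochner_Integration.integral_add Bochner_Integration.integral_diff
        Bochner_Integration.integrable_diff integrable_mult_right integral_mult_right_zero)
  finally have "(LINT x|lborel. f \<tau> x * ?A x) + (LINT x|lborel. f \<tau> x * ?u' x) =
      (LINT x|lborel. f \<tau> x * cutoff_error C \<epsilon> \<theta> (\<xi> \<tau>) x) - ?a * (LINT x|lborel. f \<tau> x * ?u \<tau> x)"
    by simp
  then show ?thesis
    using H_pairing_has_derivative[OF f \<open>0 \<le> \<tau>\<close> cont D u u' e e_lim] by simp
qed

section \<open>Removing the cutoff\<close>

lemma FP_solution_bounded:
  assumes sol: "FP_solution C f0 f"
  obtains M where "0 \<le> M" "\<And>s. s \<in> {0..t} \<Longrightarrow> H_norm (f s) \<le> M"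
proof -
  have f: "in_H (f s)" and lim: "((\<lambda>r. H_norm (\<lambda>x. f r x - f s x)) \<longlongrightarrow> 0) (at s within {0..})"
    if "0 \<le> s" for s
    using sol that by (auto simp: FP_solution_def)
  have "continuous_on {0..t} (\<lambda>s. H_norm (f s))"
    unfolding continuous_on_def
  proof
    fix s assume s: "s \<in> {0..t}"
    show "((\<lambda>s. H_norm (f s)) \<longlongrightarrow> H_norm (f s)) (at s within {0..t})"
    proof (rule Lim_null[THEN iffD2], rule Lim_null_comparison)
      show "((\<lambda>r. H_norm (\<lambda>x. f r x - f s x)) \<longlongrightarrow> 0) (at s within {0..t})"
        using s by (intro tendsto_within_subset[OF lim]) auto
      have "\<bar>H_norm (f r) - H_norm (f s)\<bar> \<le> H_norm (\<lambda>x. f r x - f s x)" if "0 \<le> r" for r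
        using H_norm_triangle[OF f[of r] f[of s]] H_norm_triangle[OF f[of s] f[of r]] s that
          H_norm_diff_commute[of "f s" "f r"] by (auto simp: abs_le_iff)
      then show "\<forall>\<^sub>F r in at s within {0..t}. norm (H_norm (f r) - H_norm (f s)) \<le> H_norm (\<lambda>x. f r x - f s x)"
        by (auto simp: eventually_at_filter)
    qed
  qed
  then have "bounded ((\<lambda>s. H_norm (f s)) ` {0..t})"
    by (intro compact_imp_bounded compact_continuous_image) auto
  then obtain M where M: "\<forall>y\<in>(\<lambda>s. H_norm (f s)) ` {0..t}. norm y \<le> M"
    by (auto simp only: bounded_iff)
  show ?thesis
  proof (rule that[of "max 0 M"])
    show "H_norm (f s) \<le> max 0 M" if "s \<in> {0..t}" for s
      using M that by (auto intro!: max.coboundedI2)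
  qed simp
qed

lemma le_0_if_le_small_multiple:
  assumes "\<And>\<epsilon>. 0 < \<epsilon> \<Longrightarrow> \<epsilon> \<le> 1 \<Longrightarrow> x \<le> \<epsilon> * c" 
  shows "x \<le> (0::real)"
proof (rule tendsto_le)
  show "((\<lambda>\<epsilon>. \<epsilon> * c) \<longlongrightarrow> 0) (at_right 0)"
    by (auto intro!: tendsto_eq_intros)
  show "((\<lambda>_. x) \<longlongrightarrow> x) (at_right (0::real))"
    by simp
  show "\<forall>\<^sub>F \<epsilon> in at_right 0. x \<le> \<epsilon> * c"
    using eventually_at_right_real[OF zero_less_one] by eventually_elim (use assms in auto)
qed simp

text \<open>The normalization of the waves compensates the change of the characters along the flow, so the
  derivative of the pairing with the cut off wave is of the order of the cutoff parameter.\<close>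

theorem FP_solution_wave_duality:
  fixes C :: "real^'n^'n"
  assumes psd: "\<And>x. 0 \<le> x \<bullet> (sym_part C *v x)"
    and sol: "FP_solution C f0 f" and f0: "in_H f0" and "0 \<le> t"
  shows "(LINT x|lborel. f t x * wave \<xi> \<theta> x) =
    (LINT x|lborel. f0 x * wave (transpose (mat_exp (- (t *\<^sub>R C))) *v \<xi>) \<theta> x)"
proof -
  \<comment> \<open>The time shift makes the curve end at \<xi> and start at
    \<open>transpose (mat_exp (- (t *\<^sub>R C))) *v \<xi>\<close>. Up to time t the exponent
    \<tau> - t is nonpositive, so the curve stays in the ball of radius |\<xi>| and the error
    constants are uniform in \<tau>.\<close>
  define y where "y \<tau> = transpose (mat_exp ((\<tau> - t) *\<^sub>R C)) *v \<xi>" for \<tau>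
  have y_t: "y t = \<xi>"
    by (simp add: y_def mat_exp_0)
  have y_0: "y 0 = transpose (mat_exp (- (t *\<^sub>R C))) *v \<xi>"
    by (simp add: y_def)
  have y': "(y has_vector_derivative transpose C *v y \<tau>) (at \<tau>)" for \<tau>
  proof -
    have "((\<lambda>\<tau>. \<tau> - t) has_vector_derivative 1) (at \<tau>)"
      by (auto intro!: derivative_eq_intros)
    from vector_diff_chain_at[OF this transpose_mat_exp_has_vector_derivative]
    show ?thesis
      unfolding y_def[abs_def] by (simp add: o_def)
  qed
  have y_le: "norm (y \<tau>) \<le> norm \<xi>" if "\<tau> \<le> t" for \<tau>
    using transpose_mat_exp_mono[OF psd, of "\<tau> - t" 0 \<xi>] that by (simp add: y_def mat_exp_0)
  have f: "in_H (f s)" if "0 \<le> s" for s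
    using sol that by (auto simp: FP_solution_def)
  obtain M where M: "0 \<le> M" "\<And>s. s \<in> {0..t} \<Longrightarrow> H_norm (f s) \<le> M"
    using FP_solution_bounded[OF sol] by blast
  let ?G = "gauss_norm (quad_weight :: real^'n \<Rightarrow> real)"
  let ?E = "exp ((norm \<xi>)\<^sup>2 / 2)" and ?K = "error_const C (norm \<xi>)"
  have K: "0 \<le> ?K"
    by (simp add: error_const_def onorm_pos_le)
  define P where "P \<epsilon> \<tau> = (LINT x|lborel. f \<tau> x * cutoff_wave \<epsilon> \<theta> (y \<tau>) x)" for \<epsilon> \<tau>
  define R where "R \<epsilon> \<tau> = (LINT x|lborel. f \<tau> x * cutoff_error C \<epsilon> \<theta> (y \<tau>) x)" for \<epsilon> \<tau>
  define w where "w \<tau> = exp ((norm (y \<tau>))\<^sup>2 / 2)" for \<tau>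
  have w_le: "w \<tau> \<le> ?E" if "\<tau> \<le> t" for \<tau>
    using y_le[OF that] by (simp add: w_def)
  have w': "(w has_real_derivative w \<tau> * (y \<tau> \<bullet> (sym_part C *v y \<tau>))) (at \<tau> within S)" for \<tau> S
  proof -
    have "((\<lambda>\<tau>. exp ((y \<tau> \<bullet> y \<tau>) / 2)) has_derivative
        (\<lambda>h. h * (exp ((y \<tau> \<bullet> y \<tau>) / 2) * (y \<tau> \<bullet> (sym_part C *v y \<tau>))))) (at \<tau>)"
      using y'[unfolded has_vector_derivative_def]
      by (auto intro!: derivative_eq_intros simp: inner_sym_part inner_commute)
    then show ?thesis
      unfolding w_def[abs_def] power2_norm_eq_inner has_field_derivative_def
      by (rule has_derivative_eq_rhs[OF has_derivative_at_withinI]) (auto simp: fun_eq_iff)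
  qed
  have m': "((\<lambda>\<tau>. w \<tau> * P \<epsilon> \<tau>) has_real_derivative w \<tau> * R \<epsilon> \<tau>) (at \<tau> within {0..t})"
    if "0 < \<epsilon>" "\<epsilon> \<le> 1" "0 \<le> \<tau>" for \<epsilon> \<tau>
  proof -
    have "(P \<epsilon> has_real_derivative R \<epsilon> \<tau> - (y \<tau> \<bullet> (sym_part C *v y \<tau>)) * P \<epsilon> \<tau>) (at \<tau> within {0..})"
      unfolding P_def[abs_def] R_def by (rule cutoff_wave_pairing_has_derivative[OF sol that y'])
    then have "(P \<epsilon> has_real_derivative R \<epsilon> \<tau> - (y \<tau> \<bullet> (sym_part C *v y \<tau>)) * P \<epsilon> \<tau>) (at \<tau> within {0..t})"
      by (rule DERIV_subset) auto
    from DERIV_mult[OF w' this] show ?thesis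
      by (simp add: algebra_simps)
  qed
  have R_le: "\<bar>R \<epsilon> \<tau>\<bar> \<le> M * (\<epsilon> * ?K * ?G)" if "0 < \<epsilon>" "\<epsilon> \<le> 1" "\<tau> \<in> {0..t}" for \<epsilon> \<tau>
  proof -
    note b = L2_gauss_bound[OF cutoff_error_measurable abs_cutoff_error_le[OF that(1,2) y_le], of \<tau> C \<theta>]
    have "\<bar>R \<epsilon> \<tau>\<bar> \<le> H_norm (f \<tau>) * gauss_norm (cutoff_error C \<epsilon> \<theta> (y \<tau>))"
      unfolding R_def using that by (intro H_Cauchy_Schwarz f b) auto
    also have "\<dots> \<le> M * (\<epsilon> * ?K * ?G)"
      using that by (intro mult_mono M b) auto
    finally show ?thesis .
  qed
  have P_le: "\<bar>(LINT x|lborel. f \<tau> x * wave (y \<tau>) \<theta> x) - w \<tau> * P \<epsilon> \<tau>\<bar> \<le> \<epsilon> * (3 * ?E * M * ?G)"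
    if "0 < \<epsilon>" "\<epsilon> \<le> 1" "\<tau> \<in> {0..t}" for \<epsilon> \<tau>
  proof -
    let ?d = "\<lambda>x. wave (y \<tau>) \<theta> x - w \<tau> * cutoff_wave \<epsilon> \<theta> (y \<tau>) x"
    have d: "\<bar>?d x\<bar> \<le> (3 * \<epsilon> * ?E) * quad_weight x" for x
    proof -
      have "?d x = w \<tau> * ((1 - bump \<epsilon> 3 x) * cos (y \<tau> \<bullet> x + \<theta>))"
        by (simp add: wave_def w_def cutoff_wave_def algebra_simps)
      also have "\<bar>\<dots>\<bar> \<le> ?E * ((3 * \<epsilon> * quad_weight x) * 1)"
        unfolding abs_mult
      proof (intro mult_mono)
        show "\<bar>1 - bump \<epsilon> 3 x\<bar> \<le> 3 * \<epsilon> * quad_weight x"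
          using that by (intro order_trans[OF one_minus_bump_le] mult_left_mono) auto
        show "\<bar>w \<tau>\<bar> \<le> ?E"
          using w_le[of \<tau>] that by (simp add: w_def)
      qed (use that in auto)
      finally show ?thesis by (simp only: mult_1_right mult_ac)
    qed
    have b: "L2_gauss ?d" "gauss_norm ?d \<le> (3 * \<epsilon> * ?E) * ?G"
      by (rule L2_gauss_bound[OF _ d], measurable)+
    have c: "L2_gauss (cutoff_wave \<epsilon> \<theta> (y \<tau>))"
      using that by (intro L2_gauss_bounded[OF cutoff_wave_measurable abs_cutoff_wave_le]) auto
    have fs: "in_H (f \<tau>)"
      using that by (intro f) auto
    have "(LINT x|lborel. f \<tau> x * wave (y \<tau>) \<theta> x) - w \<tau> * P \<epsilon> \<tau> =
        (LINT x|lborel. f \<tau> x * wave (y \<tau>) \<theta> x - w \<tau> * (f \<tau> x * cutoff_wave \<epsilon> \<theta> (y \<tau>) x))"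
      unfolding P_def using integrable_H_mult[OF fs c] integrable_H_mult[OF fs L2_gauss_wave]
      by (simp only: Bochner_Integration.integral_diff integrable_mult_right integral_mult_right_zero)
    also have "\<dots> = (LINT x|lborel. f \<tau> x * ?d x)"
      by (intro Bochner_Integration.integral_cong refl) (simp add: algebra_simps)
    also have "\<bar>\<dots>\<bar> \<le> H_norm (f \<tau>) * gauss_norm ?d"
      by (rule H_Cauchy_Schwarz[OF fs b(1)])
    also have "\<dots> \<le> M * ((3 * \<epsilon> * ?E) * ?G)"
      using that by (intro mult_mono M b) auto
    finally show ?thesis by (simp add: mult_ac)
  qed
  \<comment> \<open>The error accumulated over time, plus the cost of replacing a wave by its cut
    off version at both end points.\<close>
  let ?c = "?E * (M * (?K * ?G)) * t + 2 * (3 * ?E * M * ?G)"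
  have "\<bar>(LINT x|lborel. f t x * wave (y t) \<theta> x) - (LINT x|lborel. f 0 x * wave (y 0) \<theta> x)\<bar> \<le> \<epsilon> * ?c"
    if \<epsilon>: "0 < \<epsilon>" "\<epsilon> \<le> 1" for \<epsilon>
  proof -
    have "norm (w t * P \<epsilon> t - w 0 * P \<epsilon> 0) \<le> ?E * (M * (\<epsilon> * ?K * ?G)) * norm (t - 0)"
    proof (rule field_differentiable_bound[of "{0..t}"])
      show "((\<lambda>\<tau>. w \<tau> * P \<epsilon> \<tau>) has_field_derivative w \<tau> * R \<epsilon> \<tau>) (at \<tau> within {0..t})"
        if "\<tau> \<in> {0..t}" for \<tau>
        using m'[OF \<epsilon>] that by simp
      show "norm (w \<tau> * R \<epsilon> \<tau>) \<le> ?E * (M * (\<epsilon> * ?K * ?G))" if "\<tau> \<in> {0..t}" for \<tau>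
        unfolding norm_mult real_norm_def[symmetric] unfolding real_norm_def
        using R_le[OF \<epsilon> that] w_le[of \<tau>] that by (intro mult_mono) (auto simp: w_def)
    qed (use \<open>0 \<le> t\<close> in auto)
    then have m: "\<bar>w t * P \<epsilon> t - w 0 * P \<epsilon> 0\<bar> \<le> \<epsilon> * (?E * (M * (?K * ?G)) * t)"
      using \<open>0 \<le> t\<close> by (simp add: mult_ac)
    have "0 \<in> {0..t}" "t \<in> {0..t}"
      using \<open>0 \<le> t\<close> by auto
    from m P_le[OF \<epsilon> this(1)] P_le[OF \<epsilon> this(2)]
    have "\<bar>(LINT x|lborel. f t x * wave (y t) \<theta> x) - (LINT x|lborel. f 0 x * wave (y 0) \<theta> x)\<bar>
      \<le> \<epsilon> * (?E * (M * (?K * ?G)) * t) + \<epsilon> * (3 * ?E * M * ?G) + \<epsilon> * (3 * ?E * M * ?G)"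
      by linarith
    also have "\<dots> = \<epsilon> * ?c"
      by (simp only: distrib_left mult_2)
    finally show ?thesis .
  qed
  then have "\<bar>(LINT x|lborel. f t x * wave (y t) \<theta> x) - (LINT x|lborel. f 0 x * wave (y 0) \<theta> x)\<bar> \<le> 0"
    by (rule le_0_if_le_small_multiple)
  then have "(LINT x|lborel. f t x * wave (y t) \<theta> x) = (LINT x|lborel. f 0 x * wave (y 0) \<theta> x)"
    by simp
  \<comment> \<open>\<open>f 0\<close> and \<open>f0\<close> agree only up to a difference of norm
    0, which pairings do not see.\<close>
  also have "\<dots> = (LINT x|lborel. f0 x * wave (y 0) \<theta> x)"
    using H_pairing_diff_le[OF f[of 0] f0 L2_gauss_wave, of "y 0" \<theta>] sol by (simp add: FP_solution_def)
  finally show ?thesis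
    unfolding y_t y_0 .
qed

section \<open>The operator norm\<close>

lemma Pi0_eq: "Pi0 f x = (LINT x|lborel. f x) * f_inf x"
  by (simp add: Pi0_def H_inner_def)

lemma in_H_Pi0: "in_H (Pi0 f)"
  unfolding Pi0_eq[abs_def] in_H_mult_f_inf by (rule L2_gauss_bounded[of _ "\<bar>LINT x|lborel. f x\<bar>"]) auto

text \<open>The projection pairs with a wave to the integral of f0 times the mean cos \<theta> of
  the wave. Subtracting \<open>Pi0 f0\<close> from the solution therefore amounts to subtracting the
  constant cos \<theta> from the transported wave.\<close>

lemma
  fixes f0 :: "real^'n \<Rightarrow> real"
  assumes psd: "\<And>x. 0 \<le> x \<bullet> (sym_part C *v x)"
    and sol: "FP_solution C f0 f" and f0: "in_H f0" and t: "0 \<le> t"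
  shows in_H_decay: "in_H (\<lambda>x. f t x - Pi0 f0 x)"
    and decay_wave_pairing: "(LINT x|lborel. (f t x - Pi0 f0 x) * wave \<xi> \<theta> x) =
      (LINT x|lborel. f0 x * (wave (transpose (mat_exp (- (t *\<^sub>R C))) *v \<xi>) \<theta> x - cos \<theta>))"
proof -
  let ?\<eta> = "transpose (mat_exp (- (t *\<^sub>R C))) *v \<xi>"
  have ft: "in_H (f t)"
    using sol t by (auto simp: FP_solution_def)
  show "in_H (\<lambda>x. f t x - Pi0 f0 x)"
    by (rule in_H_diff[OF ft in_H_Pi0])
  have "(LINT x|lborel. (f t x - Pi0 f0 x) * wave \<xi> \<theta> x) =
      (LINT x|lborel. f t x * wave \<xi> \<theta> x) - (LINT x|lborel. Pi0 f0 x * wave \<xi> \<theta> x)"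
    unfolding left_diff_distrib
    by (intro Bochner_Integration.integral_diff integrable_H_mult ft in_H_Pi0 L2_gauss_wave)
  also have "(LINT x|lborel. Pi0 f0 x * wave \<xi> \<theta> x) = (LINT x|lborel. f0 x) * cos \<theta>"
  proof -
    have "Pi0 f0 x * wave \<xi> \<theta> x = (LINT x|lborel. f0 x) * (wave \<xi> \<theta> x * wave 0 0 x * f_inf x)" for x
      by (simp add: Pi0_eq)
    then show ?thesis
      by (simp only: integral_mult_right_zero integral_wave_wave) simp
  qed
  also have "(LINT x|lborel. f t x * wave \<xi> \<theta> x) = (LINT x|lborel. f0 x * wave ?\<eta> \<theta> x)"
    by (rule FP_solution_wave_duality[OF psd sol f0 t])
  also have "(LINT x|lborel. f0 x * wave ?\<eta> \<theta> x) - (LINT x|lborel. f0 x) * cos \<theta> =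
      (LINT x|lborel. f0 x * wave ?\<eta> \<theta> x) - (LINT x|lborel. f0 x * cos \<theta>)"
    by simp
  also have "\<dots> = (LINT x|lborel. f0 x * wave ?\<eta> \<theta> x - f0 x * cos \<theta>)"
    using integrable_H_mult[OF f0 L2_gauss_wave, of 0 \<theta>]
    by (intro Bochner_Integration.integral_diff[symmetric] integrable_H_mult[OF f0 L2_gauss_wave]) simp
  finally show "(LINT x|lborel. (f t x - Pi0 f0 x) * wave \<xi> \<theta> x) =
      (LINT x|lborel. f0 x * (wave ?\<eta> \<theta> x - cos \<theta>))"
    by (simp add: right_diff_distrib)
qed

text \<open>Write y = K^T x, apply the bound to y in |y|^2 = (K y) . x and cancel |y|. It serves to
  pass from K to its transpose and back.\<close>

lemma norm_transpose_mult_le: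
  fixes K :: "real^'n^'n"
  assumes "\<And>x. norm (K *v x) \<le> \<kappa> * norm x"
  shows "norm (transpose K *v x) \<le> \<kappa> * norm x"
proof (cases "transpose K *v x = 0")
  case True
  have "0 \<le> norm (K *v x)" by simp
  also have "\<dots> \<le> \<kappa> * norm x" by (rule assms)
  finally show ?thesis using True by simp
next
  case False
  let ?y = "transpose K *v x"
  have "norm ?y * norm ?y = (K *v ?y) \<bullet> x"
    by (metis inner_transpose power2_norm_eq_inner power2_eq_square)
  also have "\<dots> \<le> norm (K *v ?y) * norm x"
    by (rule norm_cauchy_schwarz)
  also have "\<dots> \<le> \<kappa> * norm ?y * norm x"
    by (intro mult_right_mono assms) auto
  also have "\<dots> = (\<kappa> * norm x) * norm ?y"
    by simp
  finally show ?thesis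
    using False by (simp only: mult_le_cancel_right) auto
qed

text \<open>The evolution is moved to the test side: pairing with p becomes pairing f0 with the
  transported and centred p, whose norm \<open>gauss_norm_wave_contraction\<close> controls. By
  density a bound on all such pairings bounds the norm.\<close>

lemma decay_upper_bound:
  assumes psd: "\<And>x. 0 \<le> x \<bullet> (sym_part C *v x)"
    and sol: "FP_solution C f0 f" and f0: "in_H f0" and t: "0 \<le> t"
    and \<kappa>: "\<And>x. norm (mat_exp (- (t *\<^sub>R C)) *v x) \<le> \<kappa> * norm x" "0 \<le> \<kappa>" "\<kappa> \<le> 1"
  shows "H_norm (\<lambda>x. f t x - Pi0 f0 x) \<le> \<kappa> * H_norm f0"
proof (rule H_norm_le_if_trig_poly_bound[OF in_H_decay[OF psd sol f0 t]])
  let ?T = "\<lambda>\<xi>. transpose (mat_exp (- (t *\<^sub>R C))) *v \<xi>"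
  let ?g = "\<lambda>x. f t x - Pi0 f0 x"
  fix p :: "real^'a \<Rightarrow> real"
  assume "trig_poly p"
  then obtain m :: nat and a \<xi> \<theta> where p: "p = (\<lambda>x. \<Sum>i<m. a i * wave (\<xi> i) (\<theta> i) x)"
    using trig_poly_eq_sum by blast
  let ?\<psi> = "\<lambda>x. \<Sum>i<m. a i * (wave (?T (\<xi> i)) (\<theta> i) x - cos (\<theta> i))"
  have L2: "L2_gauss (\<lambda>x. wave \<eta> \<omega> x - cos \<omega>)" for \<eta> :: "real^'a" and \<omega>
  proof (rule L2_gauss_bounded)
    show "\<bar>wave \<eta> \<omega> x - cos \<omega>\<bar> \<le> exp ((norm \<eta>)\<^sup>2 / 2) + 1" for x
      using abs_wave_le[of \<eta> \<omega> x] abs_cos_le_one[of \<omega>] by linarith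
  qed measurable
  have "(LINT x|lborel. ?g x * p x) = (LINT x|lborel. (\<Sum>i<m. a i * (?g x * wave (\<xi> i) (\<theta> i) x)))"
    unfolding p by (intro Bochner_Integration.integral_cong refl) (simp add: sum_distrib_left mult_ac)
  also have "\<dots> = (\<Sum>i<m. a i * (LINT x|lborel. ?g x * wave (\<xi> i) (\<theta> i) x))"
    by (subst Bochner_Integration.integral_sum)
       (auto intro!: integrable_mult_right integrable_H_mult in_H_decay[OF psd sol f0 t] L2_gauss_wave)
  also have "\<dots> = (\<Sum>i<m. a i * (LINT x|lborel. f0 x * (wave (?T (\<xi> i)) (\<theta> i) x - cos (\<theta> i))))"
    by (simp only: decay_wave_pairing[OF psd sol f0 t])
  also have "\<dots> = (LINT x|lborel. (\<Sum>i<m. a i * (f0 x * (wave (?T (\<xi> i)) (\<theta> i) x - cos (\<theta> i)))))"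
    by (subst Bochner_Integration.integral_sum) (auto intro!: integrable_mult_right integrable_H_mult f0 L2)
  also have "\<dots> = (LINT x|lborel. f0 x * ?\<psi> x)"
    by (intro Bochner_Integration.integral_cong refl) (simp add: sum_distrib_left mult_ac)
  also have "\<bar>\<dots>\<bar> \<le> H_norm f0 * gauss_norm ?\<psi>"
  proof (rule H_Cauchy_Schwarz[OF f0 L2_gauss_bounded])
    show "\<bar>?\<psi> x\<bar> \<le> (\<Sum>i<m. \<bar>a i\<bar> * (exp ((norm (?T (\<xi> i)))\<^sup>2 / 2) + 1))" for x
    proof (intro order_trans[OF sum_abs] sum_mono)
      fix i
      show "\<bar>a i * (wave (?T (\<xi> i)) (\<theta> i) x - cos (\<theta> i))\<bar> \<le> \<bar>a i\<bar> * (exp ((norm (?T (\<xi> i)))\<^sup>2 / 2) + 1)"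
        unfolding abs_mult using abs_wave_le[of "?T (\<xi> i)" "\<theta> i" x] abs_cos_le_one[of "\<theta> i"]
        by (intro mult_left_mono) linarith+
    qed
  qed measurable
  also have "\<dots> \<le> H_norm f0 * (\<kappa> * gauss_norm p)"
    unfolding p
    by (intro mult_left_mono gauss_norm_wave_contraction matrix_vector_mul_linear
        norm_transpose_mult_le \<kappa> H_norm_nonneg)
  finally show "\<bar>LINT x|lborel. ?g x * p x\<bar> \<le> \<kappa> * H_norm f0 * gauss_norm p"
    by (simp add: mult_ac)
qed (simp add: \<kappa>)

lemma sinh_square_div_tendsto: "((\<lambda>\<epsilon>. sinh (\<epsilon>\<^sup>2 * a) / \<epsilon>\<^sup>2) \<longlongrightarrow> a) (at_right (0::real))"
proof -
  have "((\<lambda>h. sinh (a * h)) has_real_derivative a) (at 0)"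
    by (auto intro!: derivative_eq_intros)
  then have "((\<lambda>h. sinh (a * h) / h) \<longlongrightarrow> a) (at 0)"
    by (simp add: DERIV_def)
  moreover have "filterlim (\<lambda>\<epsilon>::real. \<epsilon>\<^sup>2) (at 0) (at_right 0)"
    by (auto intro!: filterlim_atI tendsto_eq_intros simp: eventually_at_filter)
  ultimately have "((\<lambda>\<epsilon>. sinh (a * \<epsilon>\<^sup>2) / \<epsilon>\<^sup>2) \<longlongrightarrow> a) (at_right 0)"
    by (rule filterlim_compose)
  then show ?thesis
    by (simp add: mult.commute)
qed

text \<open>The initial data \<open>sin (\<epsilon> v \<bullet> x) f_inf\<close>, tested with \<open>sin (\<epsilon> K v \<bullet> x)\<close>,
  approach the linear functions, on which the norm of \<open>K = exp (- t C)\<close> is attained.\<close>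

lemma decay_lower_bound:
  fixes C :: "real^'n^'n" and S :: "real \<Rightarrow> (real^'n \<Rightarrow> real) \<Rightarrow> (real^'n \<Rightarrow> real)"
  assumes psd: "\<And>x. 0 \<le> x \<bullet> (sym_part C *v x)"
    and sol: "\<And>f0. in_H f0 \<Longrightarrow> FP_solution C f0 (\<lambda>t. S t f0)" and t: "0 \<le> t"
    and M: "\<And>f0. in_H f0 \<Longrightarrow> H_norm (\<lambda>x. S t f0 x - Pi0 f0 x) \<le> M * H_norm f0"
  shows "norm (mat_exp (- (t *\<^sub>R C)) *v v) \<le> M * norm v"
proof -
  let ?K = "mat_exp (- (t *\<^sub>R C))"
  \<comment> \<open>The phase - pi / 2 turns waves into sines, which have mean 0 and whose inner
    products, given by sinh, start with degree one.\<close>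
  let ?w = "?K *v v" and ?s = "\<lambda>\<xi>. wave \<xi> (- pi / 2)"
  have gn: "(gauss_norm (?s \<xi>))\<^sup>2 = sinh (\<xi> \<bullet> \<xi>)" for \<xi> :: "real^'n"
    unfolding gauss_norm_square using integral_wave_wave[of \<xi> "- pi / 2" \<xi> "- pi / 2"]
    by (simp add: power2_eq_square)
  have *: "(sinh (\<epsilon>\<^sup>2 * (?w \<bullet> ?w)))\<^sup>2 \<le> M\<^sup>2 * sinh (\<epsilon>\<^sup>2 * (v \<bullet> v)) * sinh (\<epsilon>\<^sup>2 * (?w \<bullet> ?w))" for \<epsilon>
  proof -
    let ?\<xi> = "\<epsilon> *\<^sub>R ?w" and ?v = "\<epsilon> *\<^sub>R v"
    let ?f0 = "\<lambda>x. ?s ?v x * f_inf x"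
    have f0: "in_H ?f0"
      unfolding in_H_mult_f_inf by (rule L2_gauss_wave)
    \<comment> \<open>The test frequency \<epsilon> K v is chosen because v . K^T K v = |K
      v|^2.\<close>
    have "sinh (\<epsilon>\<^sup>2 * (?w \<bullet> ?w)) = sinh (?v \<bullet> (transpose ?K *v ?\<xi>))"
      by (simp only: inner_transpose matrix_vector_mult_scaleR inner_scaleR_left inner_scaleR_right
          power2_eq_square mult.assoc)
    also have "\<dots> = (LINT x|lborel. ?f0 x * (?s (transpose ?K *v ?\<xi>) x - cos (- pi / 2)))"
      using integral_wave_wave[of ?v "- pi / 2" "transpose ?K *v ?\<xi>" "- pi / 2"] by (simp add: mult_ac)
    also have "\<dots> = (LINT x|lborel. (S t ?f0 x - Pi0 ?f0 x) * ?s ?\<xi> x)"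
      by (rule decay_wave_pairing[OF psd sol[OF f0] f0 t, symmetric])
    finally have "\<bar>sinh (\<epsilon>\<^sup>2 * (?w \<bullet> ?w))\<bar> \<le> H_norm (\<lambda>x. S t ?f0 x - Pi0 ?f0 x) * gauss_norm (?s ?\<xi>)"
      using H_Cauchy_Schwarz[OF in_H_decay[OF psd sol[OF f0] f0 t] L2_gauss_wave, of ?\<xi> "- pi / 2"] by simp
    also have "\<dots> \<le> M * gauss_norm (?s ?v) * gauss_norm (?s ?\<xi>)"
      using M[OF f0] unfolding H_norm_mult_f_inf by (intro mult_right_mono) auto
    finally have "\<bar>sinh (\<epsilon>\<^sup>2 * (?w \<bullet> ?w))\<bar>\<^sup>2 \<le> (M * gauss_norm (?s ?v) * gauss_norm (?s ?\<xi>))\<^sup>2"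
      by (intro power_mono) auto
    moreover have "(\<epsilon> *\<^sub>R u) \<bullet> (\<epsilon> *\<^sub>R u) = \<epsilon>\<^sup>2 * (u \<bullet> u)" for u :: "real^'n"
      by (simp add: power2_eq_square)
    ultimately show ?thesis
      unfolding power2_abs power_mult_distrib gn by (simp only: mult.assoc)
  qed
  \<comment> \<open>Both sides of the inequality are of order \<epsilon>^4, so every sinh is divided
    by \<epsilon>^2 before passing to the limit.\<close>
  have div: "(a / e)\<^sup>2 \<le> m * (b / e) * (a / e)" if "a\<^sup>2 \<le> m * b * a" for a b e m :: real
    using divide_right_mono[OF that, of "e\<^sup>2"] by (simp add: power_divide power2_eq_square)
  have "(?w \<bullet> ?w)\<^sup>2 \<le> M\<^sup>2 * (v \<bullet> v) * (?w \<bullet> ?w)"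
  proof (rule tendsto_le)
    show "((\<lambda>\<epsilon>. M\<^sup>2 * (sinh (\<epsilon>\<^sup>2 * (v \<bullet> v)) / \<epsilon>\<^sup>2) * (sinh (\<epsilon>\<^sup>2 * (?w \<bullet> ?w)) / \<epsilon>\<^sup>2)) \<longlongrightarrow>
        M\<^sup>2 * (v \<bullet> v) * (?w \<bullet> ?w)) (at_right 0)"
      by (rule tendsto_mult[OF tendsto_mult[OF tendsto_const sinh_square_div_tendsto] sinh_square_div_tendsto])
    show "((\<lambda>\<epsilon>. (sinh (\<epsilon>\<^sup>2 * (?w \<bullet> ?w)) / \<epsilon>\<^sup>2)\<^sup>2) \<longlongrightarrow> (?w \<bullet> ?w)\<^sup>2) (at_right 0)"
      by (rule tendsto_power[OF sinh_square_div_tendsto])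
    have "(sinh (\<epsilon>\<^sup>2 * (?w \<bullet> ?w)) / \<epsilon>\<^sup>2)\<^sup>2
        \<le> M\<^sup>2 * (sinh (\<epsilon>\<^sup>2 * (v \<bullet> v)) / \<epsilon>\<^sup>2) * (sinh (\<epsilon>\<^sup>2 * (?w \<bullet> ?w)) / \<epsilon>\<^sup>2)" for \<epsilon>
      by (rule div[OF *])
    then show "\<forall>\<^sub>F \<epsilon> in at_right 0. (sinh (\<epsilon>\<^sup>2 * (?w \<bullet> ?w)) / \<epsilon>\<^sup>2)\<^sup>2
        \<le> M\<^sup>2 * (sinh (\<epsilon>\<^sup>2 * (v \<bullet> v)) / \<epsilon>\<^sup>2) * (sinh (\<epsilon>\<^sup>2 * (?w \<bullet> ?w)) / \<epsilon>\<^sup>2)"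
      by (rule always_eventually[OF allI])
  qed simp
  then have "(?w \<bullet> ?w) * (?w \<bullet> ?w) \<le> (M\<^sup>2 * (v \<bullet> v)) * (?w \<bullet> ?w)"
    by (simp only: power2_eq_square)
  then have "?w \<bullet> ?w \<le> M\<^sup>2 * (v \<bullet> v)"
    by (cases "?w = 0") (auto simp: mult_le_cancel_right)
  then have le: "(norm ?w)\<^sup>2 \<le> (M * norm v)\<^sup>2"
    by (simp only: power2_norm_eq_inner power_mult_distrib)
  \<comment> \<open>Squares give the bound only with |M|; the sign comes from the hypothesis at the
    initial datum f_inf, which has norm 1.\<close>
  have "0 \<le> M"
  proof -
    have L: "L2_gauss (\<lambda>x::real^'n. 1)"
      by (rule L2_gauss_bounded[of _ 1]) auto
    have "0 \<le> H_norm (\<lambda>x. S t (\<lambda>x. 1 * f_inf x) x - Pi0 (\<lambda>x. 1 * f_inf x) x)"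
      by simp
    also have "\<dots> \<le> M * gauss_norm (\<lambda>x::real^'n. 1)"
      using M[of "\<lambda>x. 1 * f_inf x"] L unfolding in_H_mult_f_inf H_norm_mult_f_inf by blast
    also have "gauss_norm (\<lambda>x::real^'n. 1) = 1"
      using integral_wave_wave[of "0::real^'n" 0 0 0] by (simp add: gauss_norm_def)
    finally show ?thesis by simp
  qed
  then show ?thesis
    by (intro power2_le_imp_le[OF le]) simp
qed

theorem theorem3p4:
  fixes C :: "real^'n^'n"
    and S :: "real \<Rightarrow> (real^'n \<Rightarrow> real) \<Rightarrow> (real^'n \<Rightarrow> real)"
  assumes condA: "conditionA C"
    and sol: "\<And>f0. in_H f0 \<Longrightarrow> FP_solution C f0 (\<lambda>t. S t f0)"
    and t: "t \<ge> 0"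
  shows "Sup {H_norm (\<lambda>x. S t f0 x - Pi0 f0 x) / H_norm f0 | f0. in_H f0 \<and> H_norm f0 \<noteq> 0}
       = Sup {norm (mat_exp (- (t *\<^sub>R C)) *v x0) / norm x0 | x0 :: real^'n. x0 \<noteq> 0}"
    (is "Sup ?A = Sup ?B")
proof -
  let ?K = "mat_exp (- (t *\<^sub>R C))"
  have psd: "0 \<le> x \<bullet> (sym_part C *v x)" for x
    using condA by (simp add: conditionA_def)
  \<comment> \<open>Monotonicity along the flow concerns the transpose;
    \<open>norm_transpose_mult_le\<close> carries the contraction over to \<open>?K\<close>
    itself.\<close>
  have "norm (transpose ?K *v x) \<le> 1 * norm x" for x
    using transpose_mat_exp_mono[OF psd, of "- t" 0 x] t by (simp add: mat_exp_0)
  then have contr: "norm (?K *v x) \<le> 1 * norm x" for x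
    using norm_transpose_mult_le[of "transpose ?K" 1 x] by (simp only: transpose_transpose)
  \<comment> \<open>\<open>Sup\<close> on the reals is informative only for nonempty sets bounded
    above, so both properties are established for each of the two sets.\<close>
  have bddB: "bdd_above ?B"
    using contr by (intro bdd_aboveI[of _ 1]) (auto simp: divide_le_eq)
  define e :: "real^'n" where "e = axis undefined 1"
  have "e \<noteq> 0"
    by (simp add: e_def axis_eq_0_iff)
  then have "norm (?K *v e) / norm e \<in> ?B"
    by blast
  then have neB: "?B \<noteq> {}" by blast
  have K_le: "norm (?K *v x) \<le> Sup ?B * norm x" for x
  proof (cases "x = 0")
    case False
    then have "norm (?K *v x) / norm x \<le> Sup ?B"
      by (intro cSup_upper bddB) auto
    then show ?thesis
      using False by (simp add: divide_le_eq)
  qed simp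
  have "0 \<le> Sup ?B"
    using \<open>norm (?K *v e) / norm e \<in> ?B\<close> by (rule cSup_upper2) (auto simp: bddB)
  have "Sup ?B \<le> 1"
    using contr by (intro cSup_least neB) (auto simp: divide_le_eq)
  have upper: "H_norm (\<lambda>x. S t f0 x - Pi0 f0 x) \<le> Sup ?B * H_norm f0" if "in_H f0" for f0
    using decay_upper_bound[OF psd sol[OF that] that t K_le \<open>0 \<le> Sup ?B\<close> \<open>Sup ?B \<le> 1\<close>] .
  have A_le: "a \<le> Sup ?B" if "a \<in> ?A" for a
  proof -
    from that obtain f0 where f0: "in_H f0" "H_norm f0 \<noteq> 0"
      and a: "a = H_norm (\<lambda>x. S t f0 x - Pi0 f0 x) / H_norm f0" by blast
    then have "0 < H_norm f0"
      using H_norm_nonneg[of f0] by linarith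
    then show ?thesis
      using upper[OF f0(1)] by (simp add: a divide_le_eq)
  qed
  then have bddA: "bdd_above ?A"
    by (rule bdd_aboveI)
  have L: "L2_gauss (\<lambda>x::real^'n. 1)"
    by (rule L2_gauss_bounded[of _ 1]) auto
  \<comment> \<open>The stationary state is a datum of norm 1, which makes \<open>?A\<close>
    nonempty.\<close>
  have "H_norm (\<lambda>x::real^'n. 1 * f_inf x) = 1"
    unfolding H_norm_mult_f_inf
    using integral_wave_wave[of "0::real^'n" 0 0 0] by (simp add: gauss_norm_def)
  then have neA: "?A \<noteq> {}"
    using L unfolding in_H_mult_f_inf[symmetric] by fastforce
  have lower: "H_norm (\<lambda>x. S t f0 x - Pi0 f0 x) \<le> Sup ?A * H_norm f0" if "in_H f0" for f0
  proof (cases "H_norm f0 = 0")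
    case True
    \<comment> \<open>A datum of norm 0 contributes no element to \<open>?A\<close>; here the upper
      bound forces the left side to vanish.\<close>
    then show ?thesis using upper[OF that] by simp
  next
    case False
    then have "H_norm (\<lambda>x. S t f0 x - Pi0 f0 x) / H_norm f0 \<le> Sup ?A"
      using that by (intro cSup_upper bddA) auto
    then show ?thesis
      using False less_le[of 0 "H_norm f0"] by (simp add: divide_le_eq)
  qed
  show ?thesis
  proof (rule antisym)
    show "Sup ?A \<le> Sup ?B"
      by (rule cSup_least[OF neA A_le])
    show "Sup ?B \<le> Sup ?A"
    proof (rule cSup_least[OF neB])
      fix b assume "b \<in> ?B"
      then show "b \<le> Sup ?A"
        using decay_lower_bound[OF psd sol t lower] by (auto simp: divide_le_eq)
    qed
  qed
qed

end
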